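(* The logic $\text{Ł}_{\mathrm{Chang}}$ is finitely strongly complete with respect to $\mathcal V$.
   Context: **BL-algebras.** A BL-algebra is $\mathcal A=\langle A,*,\Rightarrow,\sqcap,\sqcup,0,1\rangle$ such that $\langle A,\sqcap,\sqcup,0,1\rangle$ is a bounded lattice, $\langle A,*,1\rangle$ is a commutative monoid, $z*x\le y$ iff $z\le x\Rightarrow y$, and $(x\Rightarrow y)\sqcup(y\Rightarrow x)=1$, $x\sqcap y=x*(x\Rightarrow y)$. **Logic.** Formulas are built from a denumerable set $VAR$ of variables with $\&,\to,\bot$. Derived connectives: $\neg\varphi=\varphi\to\bot$, $\varphi\leftrightarrow\psi=(\varphi\to\psi)\&(\psi\to\varphi)$, $\varphi^2=\varphi\&\varphi$, $2\varphi=\neg(\neg\varphi\&\neg\varphi)$. BL has modus ponens as only rule and axioms: $(\varphi\to\psi)\to((\psi\to\chi)\to(\varphi\to\chi))$; $(\varphi\&\psi)\to\varphi$; $(\varphi\&\psi)\to(\psi\&\varphi)$; $(\varphi\&(\varphi\to\psi))\to(\psi\&(\psi\to\varphi))$; $(\varphi\to(\psi\to\chi))\to((\varphi\&\psi)\to\chi)$; $((\varphi\&\psi)\to\chi)\to(\varphi\to(\psi\to\chi))$; $((\varphi\to\psi)\to\chi)\to(((\psi\to\varphi)\to\chi)\to\chi)$; $\bot\to\varphi$. Łukasiewicz logic Ł is BL plus $\neg\neg\varphi\to\varphi$. $\text{Ł}_{\mathrm{Chang}}$ is Ł plus the axiom schema $(2\varphi)^2\leftrightarrow2(\varphi^2)$.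 $T\vdash_L\varphi$ denotes derivability of $\varphi$ from a set of formulas $T$ in $L$. **Semantics.** An $\mathcal A$-evaluation $v$ maps $VAR$ to $A$ and is extended to formulas by interpreting $\&,\to,\bot$ as $*,\Rightarrow,0$. $T\models_{\mathcal A}\varphi$ means: every $\mathcal A$-evaluation $v$ with $v(\psi)=1$ for all $\psi\in T$ satisfies $v(\varphi)=1$. $L$ is finitely strongly complete with respect to $\mathcal A$ if for every finite set $T$ of formulas and every formula $\varphi$: $T\vdash_L\varphi$ iff $T\models_{\mathcal A}\varphi$. **Hoops.** A hoop is $\langle A,*,\Rightarrow,1\rangle$ with $\langle A,*,1\rangle$ a commutative monoid and $x\Rightarrow x=1$, $x\Rightarrow(y\Rightarrow z)=(x*y)\Rightarrow z$, $x*(x\Rightarrow y)=y*(y\Rightarrow x)$; its order is $x\le y$ iff $x\Rightarrow y=1$. It is cancellative if $x=y\Rightarrow(x*y)$ holds. The standard cancellative hoop $(0,1]_C$ is $(0,1]$ with ordinary product and $x\Rightarrow y=\min(1,y/x)$. **Disconnected rotation.** For a cancellative hoop $\mathcal A$, let $A'=\{a':a\in A\}$ be a disjoint copy of $A$ with the inverse order, and $A^*=A\cup A'$ with $a'<b$ for all $a,b\in A$. Put $1=1_{\mathcal A}$, $0=1'$, $\sim a=a'$ and $\sim a'=a$ for $a\in A$; lattice operations come from the order. The product $a*b$ is: $a*_{\mathcal A}b$ if $a,b\in A$; $\sim(a\Rightarrow_{\mathcal A}\sim b)$ if $a\in A,b\in A'$; $\sim(b\Rightarrow_{\mathcal A}\sim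 a)$ if $a\in A',b\in A$; $0$ if $a,b\in A'$. The implication $a\Rightarrow b$ is: $a\Rightarrow_{\mathcal A}b$ if $a,b\in A$; $\sim(a*_{\mathcal A}\sim b)$ if $a\in A,b\in A'$; $1$ if $a\in A',b\in A$; $(\sim b)\Rightarrow_{\mathcal A}(\sim a)$ if $a,b\in A'$. The result $\mathcal A^*$ is the disconnected rotation of $\mathcal A$. Let $\mathcal V=((0,1]_C)^*$. *)

theory Defs
  imports Complex_Main "HOL-Algebra.Lattice" "HOL-Algebra.Group"
begin

section \<open>Hoops and BL-algebras\<close>

record 'a hoop = "'a monoid" +
  impl :: "'a \<Rightarrow> 'a \<Rightarrow> 'a"

locale hoop = comm_monoid A for A :: "('a, 'm) hoop_scheme" +
  assumes impl_closed: "\<lbrakk>x \<in> carrier A; y \<in> carrier A\<rbrakk> \<Longrightarrow> impl A x y \<in> carrier A"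
    and impl_refl: "x \<in> carrier A \<Longrightarrow> impl A x x = one A"
    and impl_mult: "\<lbrakk>x \<in> carrier A; y \<in> carrier A; z \<in> carrier A\<rbrakk>
      \<Longrightarrow> impl A x (impl A y z) = impl A (mult A x y) z"
    and divisibility: "\<lbrakk>x \<in> carrier A; y \<in> carrier A\<rbrakk>
      \<Longrightarrow> mult A x (impl A x y) = mult A y (impl A y x)"

definition hoop_le :: "('a, 'm) hoop_scheme \<Rightarrow> 'a \<Rightarrow> 'a \<Rightarrow> bool" where
  "hoop_le A x y \<longleftrightarrow> impl A x y = one A"

locale cancellative_hoop = hoop +
  assumes cancellative: "\<lbrakk>x \<in> carrier A; y \<in> carrier A\<rbrakk> \<Longrightarrow> x = impl A y (mult A x y)"

text \<open>The lattice part is given by operations on the carrier, hence by equations; the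
  lattice order is \<open>x \<sqinter> y = x\<close>.\<close>

record 'a bl_algebra = "'a hoop" +
  bl_inf :: "'a \<Rightarrow> 'a \<Rightarrow> 'a"
  bl_sup :: "'a \<Rightarrow> 'a \<Rightarrow> 'a"
  bl_zero :: 'a

definition bl_le :: "('a, 'm) bl_algebra_scheme \<Rightarrow> 'a \<Rightarrow> 'a \<Rightarrow> bool" where
  "bl_le A x y \<longleftrightarrow> bl_inf A x y = x"

locale bl_algebra = comm_monoid A for A :: "('a, 'm) bl_algebra_scheme" +
  assumes impl_closed: "\<lbrakk>x \<in> carrier A; y \<in> carrier A\<rbrakk> \<Longrightarrow> impl A x y \<in> carrier A"
    and inf_closed: "\<lbrakk>x \<in> carrier A; y \<in> carrier A\<rbrakk> \<Longrightarrow> bl_inf A x y \<in> carrier A"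
    and sup_closed: "\<lbrakk>x \<in> carrier A; y \<in> carrier A\<rbrakk> \<Longrightarrow> bl_sup A x y \<in> carrier A"
    and zero_closed: "bl_zero A \<in> carrier A"
    and inf_commute: "\<lbrakk>x \<in> carrier A; y \<in> carrier A\<rbrakk> \<Longrightarrow> bl_inf A x y = bl_inf A y x"
    and sup_commute: "\<lbrakk>x \<in> carrier A; y \<in> carrier A\<rbrakk> \<Longrightarrow> bl_sup A x y = bl_sup A y x"
    and inf_assoc: "\<lbrakk>x \<in> carrier A; y \<in> carrier A; z \<in> carrier A\<rbrakk>
      \<Longrightarrow> bl_inf A (bl_inf A x y) z = bl_inf A x (bl_inf A y z)"
    and sup_assoc: "\<lbrakk>x \<in> carrier A; y \<in> carrier A; z \<in> carrier A\<rbrakk>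
      \<Longrightarrow> bl_sup A (bl_sup A x y) z = bl_sup A x (bl_sup A y z)"
    and inf_sup_absorb: "\<lbrakk>x \<in> carrier A; y \<in> carrier A\<rbrakk> \<Longrightarrow> bl_inf A x (bl_sup A x y) = x"
    and sup_inf_absorb: "\<lbrakk>x \<in> carrier A; y \<in> carrier A\<rbrakk> \<Longrightarrow> bl_sup A x (bl_inf A x y) = x"
    and zero_least: "x \<in> carrier A \<Longrightarrow> bl_le A (bl_zero A) x"
    and one_greatest: "x \<in> carrier A \<Longrightarrow> bl_le A x (one A)"
    and residuation: "\<lbrakk>x \<in> carrier A; y \<in> carrier A; z \<in> carrier A\<rbrakk>
      \<Longrightarrow> bl_le A (mult A z x) y \<longleftrightarrow> bl_le A z (impl A x y)"
    and prelinearity: "\<lbrakk>x \<in> carrier A; y \<in> carrier A\<rbrakk>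
      \<Longrightarrow> bl_sup A (impl A x y) (impl A y x) = one A"
    and inf_divisibility: "\<lbrakk>x \<in> carrier A; y \<in> carrier A\<rbrakk>
      \<Longrightarrow> bl_inf A x y = mult A x (impl A x y)"


section \<open>Formulas and logics\<close>

datatype form =
    Var nat
  | Conj form form (infixr "\<^bold>&" 70)
  | Imp form form (infixr "\<^bold>\<rightarrow>" 60)
  | Bot ("\<^bold>\<bottom>")

definition Neg :: "form \<Rightarrow> form" where
  "Neg \<phi> = (\<phi> \<^bold>\<rightarrow> \<^bold>\<bottom>)"

definition Iff :: "form \<Rightarrow> form \<Rightarrow> form" (infix "\<^bold>\<leftrightarrow>" 55) where
  "(\<phi> \<^bold>\<leftrightarrow> \<psi>) = ((\<phi> \<^bold>\<rightarrow> \<psi>) \<^bold>& (\<psi> \<^bold>\<rightarrow> \<phi>))"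

definition Sq :: "form \<Rightarrow> form" where
  "Sq \<phi> = (\<phi> \<^bold>& \<phi>)"

definition Dbl :: "form \<Rightarrow> form" where
  "Dbl \<phi> = Neg (Neg \<phi> \<^bold>& Neg \<phi>)"

text \<open>Modus ponens is the only rule throughout, so a logic is represented by its set of axioms.\<close>

type_synonym logic = "form set"

inductive_set BL :: logic where
  "((\<phi> \<^bold>\<rightarrow> \<psi>) \<^bold>\<rightarrow> ((\<psi> \<^bold>\<rightarrow> \<chi>) \<^bold>\<rightarrow> (\<phi> \<^bold>\<rightarrow> \<chi>))) \<in> BL"
| "((\<phi> \<^bold>& \<psi>) \<^bold>\<rightarrow> \<phi>) \<in> BL"
| "((\<phi> \<^bold>& \<psi>) \<^bold>\<rightarrow> (\<psi> \<^bold>& \<phi>)) \<in> BL"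
| "((\<phi> \<^bold>& (\<phi> \<^bold>\<rightarrow> \<psi>)) \<^bold>\<rightarrow> (\<psi> \<^bold>& (\<psi> \<^bold>\<rightarrow> \<phi>))) \<in> BL"
| "((\<phi> \<^bold>\<rightarrow> (\<psi> \<^bold>\<rightarrow> \<chi>)) \<^bold>\<rightarrow> ((\<phi> \<^bold>& \<psi>) \<^bold>\<rightarrow> \<chi>)) \<in> BL"
| "(((\<phi> \<^bold>& \<psi>) \<^bold>\<rightarrow> \<chi>) \<^bold>\<rightarrow> (\<phi> \<^bold>\<rightarrow> (\<psi> \<^bold>\<rightarrow> \<chi>))) \<in> BL"
| "(((\<phi> \<^bold>\<rightarrow> \<psi>) \<^bold>\<rightarrow> \<chi>) \<^bold>\<rightarrow> (((\<psi> \<^bold>\<rightarrow> \<phi>) \<^bold>\<rightarrow> \<chi>) \<^bold>\<rightarrow> \<chi>)) \<in> BL"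
| "(\<^bold>\<bottom> \<^bold>\<rightarrow> \<phi>) \<in> BL"

definition Luk :: logic where
  "Luk = BL \<union> {Neg (Neg \<phi>) \<^bold>\<rightarrow> \<phi> | \<phi>. True}"

definition Luk_Chang :: logic where
  "Luk_Chang = Luk \<union> {Sq (Dbl \<phi>) \<^bold>\<leftrightarrow> Dbl (Sq \<phi>) | \<phi>. True}"

inductive derivable :: "logic \<Rightarrow> form set \<Rightarrow> form \<Rightarrow> bool" for L T where
  ax: "\<phi> \<in> L \<Longrightarrow> derivable L T \<phi>"
| hyp: "\<phi> \<in> T \<Longrightarrow> derivable L T \<phi>"
| mp: "derivable L T \<phi> \<Longrightarrow> derivable L T (\<phi> \<^bold>\<rightarrow> \<psi>) \<Longrightarrow> derivable L T \<psi>"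


section \<open>Semantics\<close>

definition evaluation :: "('a, 'm) bl_algebra_scheme \<Rightarrow> (nat \<Rightarrow> 'a) \<Rightarrow> bool" where
  "evaluation A v \<longleftrightarrow> (\<forall>n. v n \<in> carrier A)"

primrec eval_form :: "('a, 'm) bl_algebra_scheme \<Rightarrow> (nat \<Rightarrow> 'a) \<Rightarrow> form \<Rightarrow> 'a" where
  "eval_form A v (Var n) = v n"
| "eval_form A v (\<phi> \<^bold>& \<psi>) = mult A (eval_form A v \<phi>) (eval_form A v \<psi>)"
| "eval_form A v (\<phi> \<^bold>\<rightarrow> \<psi>) = impl A (eval_form A v \<phi>) (eval_form A v \<psi>)"
| "eval_form A v \<^bold>\<bottom> = bl_zero A"

definition entails :: "('a, 'm) bl_algebra_scheme \<Rightarrow> form set \<Rightarrow> form \<Rightarrow> bool" where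
  "entails A T \<phi> \<longleftrightarrow>
    (\<forall>v. evaluation A v \<longrightarrow> (\<forall>\<psi>\<in>T. eval_form A v \<psi> = one A) \<longrightarrow> eval_form A v \<phi> = one A)"

definition finitely_strongly_complete :: "logic \<Rightarrow> ('a, 'm) bl_algebra_scheme \<Rightarrow> bool" where
  "finitely_strongly_complete L A \<longleftrightarrow>
    (\<forall>T \<phi>. finite T \<longrightarrow> (derivable L T \<phi> \<longleftrightarrow> entails A T \<phi>))"


section \<open>Disconnected rotation\<close>

text \<open>\<open>Inl a\<close> stands for \<open>a \<in> A\<close>, and \<open>Inr a\<close> for its copy \<open>a' \<in> A'\<close>.\<close>

fun rot_neg :: "'a + 'a \<Rightarrow> 'a + 'a" where
  "rot_neg (Inl a) = Inr a"
| "rot_neg (Inr a) = Inl a"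

fun rot_le :: "('a, 'm) hoop_scheme \<Rightarrow> 'a + 'a \<Rightarrow> 'a + 'a \<Rightarrow> bool" where
  "rot_le A (Inl a) (Inl b) = hoop_le A a b"
| "rot_le A (Inl a) (Inr b) = False"
| "rot_le A (Inr a) (Inl b) = True"
| "rot_le A (Inr a) (Inr b) = hoop_le A b a"

fun rot_mult :: "('a, 'm) hoop_scheme \<Rightarrow> 'a + 'a \<Rightarrow> 'a + 'a \<Rightarrow> 'a + 'a" where
  "rot_mult A (Inl a) (Inl b) = Inl (mult A a b)"
| "rot_mult A (Inl a) (Inr b) = rot_neg (Inl (impl A a b))"
| "rot_mult A (Inr a) (Inl b) = rot_neg (Inl (impl A b a))"
| "rot_mult A (Inr a) (Inr b) = Inr (one A)"

fun rot_impl :: "('a, 'm) hoop_scheme \<Rightarrow> 'a + 'a \<Rightarrow> 'a + 'a \<Rightarrow> 'a + 'a" where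
  "rot_impl A (Inl a) (Inl b) = Inl (impl A a b)"
| "rot_impl A (Inl a) (Inr b) = rot_neg (Inl (mult A a b))"
| "rot_impl A (Inr a) (Inl b) = Inl (one A)"
| "rot_impl A (Inr a) (Inr b) = Inl (impl A b a)"

definition rot_order :: "('a, 'm) hoop_scheme \<Rightarrow> ('a + 'a) gorder" where
  "rot_order A = \<lparr>carrier = carrier A <+> carrier A, eq = (=), le = rot_le A\<rparr>"

definition disconnected_rotation :: "('a, 'm) hoop_scheme \<Rightarrow> ('a + 'a) bl_algebra" where
  "disconnected_rotation A =
    \<lparr>carrier = carrier A <+> carrier A,
     mult = rot_mult A,
     one = Inl (one A),
     impl = rot_impl A,
     bl_inf = Lattice.meet (rot_order A),
     bl_sup = Lattice.join (rot_order A),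
     bl_zero = Inr (one A)\<rparr>"

definition std_cancellative_hoop :: "real hoop" where
  "std_cancellative_hoop =
    \<lparr>carrier = {0<..1}, mult = (*), one = 1, impl = (\<lambda>x y. min 1 (y / x))\<rparr>"

definition V_alg :: "(real + real) bl_algebra" where
  "V_alg = disconnected_rotation std_cancellative_hoop"

lemma cancellative_hoop_std: "cancellative_hoop std_cancellative_hoop"
proof -
  have m: "comm_monoid std_cancellative_hoop"
    by (rule comm_monoidI) (auto simp: std_cancellative_hoop_def mult_le_one)
  interpret comm_monoid std_cancellative_hoop by (rule m)
  have *: "x * y \<le> z" if "0 < x" "x \<le> 1" "0 < y" "y \<le> z" for x y z :: real
    using mult_left_le_one_le[of y x] that by linarith
  show ?thesis
    by unfold_locales
      (auto simp: std_cancellative_hoop_def min_def field_simps mult_le_one intro: *)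
qed

lemma carrier_V: "x \<in> carrier V_alg \<longleftrightarrow> (\<exists>a. 0 < a \<and> a \<le> 1 \<and> (x = Inl a \<or> x = Inr a))"
  by (auto simp: V_alg_def disconnected_rotation_def std_cancellative_hoop_def)

abbreviation V_le :: "real + real \<Rightarrow> real + real \<Rightarrow> bool" where
  "V_le \<equiv> rot_le std_cancellative_hoop"

lemma hoop_le_std: "0 < a \<Longrightarrow> hoop_le std_cancellative_hoop a b \<longleftrightarrow> a \<le> b"
  by (auto simp: hoop_le_def std_cancellative_hoop_def min_def field_simps)

lemma V_le_refl: "x \<in> carrier V_alg \<Longrightarrow> V_le x x"
  by (auto simp: carrier_V hoop_le_std)

lemma V_le_total: "x \<in> carrier V_alg \<Longrightarrow> y \<in> carrier V_alg \<Longrightarrow> V_le x y \<or> V_le y x"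
  by (auto simp: carrier_V hoop_le_std)

lemma V_le_antisym:
  "x \<in> carrier V_alg \<Longrightarrow> y \<in> carrier V_alg \<Longrightarrow> V_le x y \<Longrightarrow> V_le y x \<Longrightarrow> x = y"
  by (auto simp: carrier_V hoop_le_std)

lemma V_le_trans:
  "x \<in> carrier V_alg \<Longrightarrow> y \<in> carrier V_alg \<Longrightarrow> z \<in> carrier V_alg
    \<Longrightarrow> V_le x y \<Longrightarrow> V_le y z \<Longrightarrow> V_le x z"
  by (auto simp: carrier_V hoop_le_std)

lemma carrier_V_order: "carrier (rot_order std_cancellative_hoop) = carrier V_alg"
  by (simp add: rot_order_def V_alg_def disconnected_rotation_def)

lemma le_V_order: "le (rot_order std_cancellative_hoop) = V_le"
  by (simp add: rot_order_def)

lemma bl_inf_V: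
  assumes "x \<in> carrier V_alg" "y \<in> carrier V_alg"
  shows "bl_inf V_alg x y = (if V_le x y then x else y)"
proof -
  let ?m = "if V_le x y then x else y"
  have "greatest (rot_order std_cancellative_hoop) z (Lower (rot_order std_cancellative_hoop) {x, y})
      \<longleftrightarrow> z = ?m" for z
    unfolding greatest_def Lower_def carrier_V_order le_V_order
    using assms V_le_refl[of x] V_le_refl[of y] V_le_total[of x y] V_le_antisym[of z ?m]
    by (auto split: if_splits)
  then show ?thesis
    by (simp add: V_alg_def disconnected_rotation_def meet_def inf_def)
qed

lemma bl_sup_V:
  assumes "x \<in> carrier V_alg" "y \<in> carrier V_alg"
  shows "bl_sup V_alg x y = (if V_le x y then y else x)"
proof -
  let ?m = "if V_le x y then y else x"
  have "least (rot_order std_cancellative_hoop) z (Upper (rot_order std_cancellative_hoop) {x, y})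
      \<longleftrightarrow> z = ?m" for z
    unfolding least_def Upper_def carrier_V_order le_V_order
    using assms V_le_refl[of x] V_le_refl[of y] V_le_total[of x y] V_le_antisym[of z ?m]
    by (auto split: if_splits)
  then show ?thesis
    by (simp add: V_alg_def disconnected_rotation_def join_def sup_def)
qed

lemma bl_le_V:
  "x \<in> carrier V_alg \<Longrightarrow> y \<in> carrier V_alg \<Longrightarrow> bl_le V_alg x y \<longleftrightarrow> V_le x y"
  using V_le_antisym V_le_total by (auto simp: bl_le_def bl_inf_V V_le_refl)

lemma V_simps:
  "one V_alg = Inl 1" "bl_zero V_alg = Inr 1"
  "mult V_alg (Inl a) (Inl b) = Inl (a * b)"
  "mult V_alg (Inl a) (Inr b) = Inr (min 1 (b / a))"
  "mult V_alg (Inr a) (Inl b) = Inr (min 1 (a / b))"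
  "mult V_alg (Inr a) (Inr b) = Inr 1"
  "impl V_alg (Inl a) (Inl b) = Inl (min 1 (b / a))"
  "impl V_alg (Inl a) (Inr b) = Inr (a * b)"
  "impl V_alg (Inr a) (Inl b) = Inl 1"
  "impl V_alg (Inr a) (Inr b) = Inl (min 1 (a / b))"
  by (simp_all add: V_alg_def disconnected_rotation_def std_cancellative_hoop_def)

lemma bl_algebra_V: "bl_algebra V_alg"
proof -
  have min1: "min 1 (min 1 u / a) = min 1 (u / a)" "min 1 (1 / a) = 1"
    if "0 < a" "a \<le> 1" for a u :: real
  proof -
    have "1 \<le> 1 / a" using that by simp
    then show "min 1 (1 / a) = 1" by simp
    have "min 1 u / a = min (1 / a) (u / a)"
      using that by (simp add: min_def divide_le_cancel)
    with \<open>1 \<le> 1 / a\<close> show "min 1 (min 1 u / a) = min 1 (u / a)" by linarith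
  qed
  have le_min: "c \<le> min 1 (b / a) \<longleftrightarrow> c * a \<le> b" if "0 < a" "c \<le> 1" for a b c :: real
    using that by (simp add: pos_le_divide_eq)
  have m: "comm_monoid V_alg"
  proof (rule comm_monoidI)
    fix x y z assume "x \<in> carrier V_alg" "y \<in> carrier V_alg" "z \<in> carrier V_alg"
    then show "mult V_alg (mult V_alg x y) z = mult V_alg x (mult V_alg y z)"
      by (auto simp: carrier_V V_simps min1 mult_le_one mult.commute mult.left_commute simp del: min_less_iff_conj)
  qed (auto simp: carrier_V V_simps mult_le_one)
  interpret comm_monoid V_alg by (rule m)
  have impl_closed: "impl V_alg x y \<in> carrier V_alg"
    if "x \<in> carrier V_alg" "y \<in> carrier V_alg" for x y
    using that by (auto simp: carrier_V V_simps mult_le_one)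
  have zero_closed: "bl_zero V_alg \<in> carrier V_alg"
    by (auto simp: carrier_V V_simps)
  have chain: "bl_sup V_alg x y \<in> carrier V_alg" "bl_inf V_alg x y \<in> carrier V_alg"
    if "x \<in> carrier V_alg" "y \<in> carrier V_alg" for x y
    using that by (simp_all add: bl_inf_V bl_sup_V)
  have impl_iff: "V_le (mult V_alg z x) y \<longleftrightarrow> V_le z (impl V_alg x y)"
    if "x \<in> carrier V_alg" "y \<in> carrier V_alg" "z \<in> carrier V_alg" for x y z
    using that by (auto simp: carrier_V V_simps hoop_le_std le_min mult.commute simp del: min.bounded_iff)
  show ?thesis
  proof unfold_locales
    fix x y assume xy: "x \<in> carrier V_alg" "y \<in> carrier V_alg"
    show "bl_inf V_alg x y = bl_inf V_alg y x" "bl_sup V_alg x y = bl_sup V_alg y x"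
      using xy V_le_antisym[of x y] V_le_total[of x y] by (auto simp: bl_inf_V bl_sup_V)
    show "bl_inf V_alg x (bl_sup V_alg x y) = x" "bl_sup V_alg x (bl_inf V_alg x y) = x"
      using xy V_le_antisym[of x y] V_le_total[of x y] chain[of x y]
      by (auto simp: bl_inf_V bl_sup_V V_le_refl)
    show "bl_sup V_alg (impl V_alg x y) (impl V_alg y x) = one V_alg"
      using xy impl_closed[of x y] impl_closed[of y x]
      by (auto simp: bl_sup_V) (auto simp: carrier_V V_simps hoop_le_std min_def field_simps split: if_splits)
    show "bl_inf V_alg x y = mult V_alg x (impl V_alg x y)"
      using xy by (simp add: bl_inf_V) (auto simp: carrier_V V_simps hoop_le_std min_def field_simps)
  next
    fix x y z assume xyz: "x \<in> carrier V_alg" "y \<in> carrier V_alg" "z \<in> carrier V_alg"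
    have antisym: "V_le x y \<longrightarrow> V_le y x \<longrightarrow> x = y" "V_le y z \<longrightarrow> V_le z y \<longrightarrow> y = z"
      "V_le x z \<longrightarrow> V_le z x \<longrightarrow> x = z"
      using xyz V_le_antisym by blast+
    have total: "V_le x y \<or> V_le y x" "V_le y z \<or> V_le z y" "V_le x z \<or> V_le z x"
      using xyz V_le_total by blast+
    have trans: "V_le x y \<longrightarrow> V_le y z \<longrightarrow> V_le x z" "V_le z y \<longrightarrow> V_le y x \<longrightarrow> V_le z x"
      using xyz V_le_trans by blast+
    have "bl_inf V_alg (bl_inf V_alg x y) z = bl_inf V_alg x (bl_inf V_alg y z) \<and>
      bl_sup V_alg (bl_sup V_alg x y) z = bl_sup V_alg x (bl_sup V_alg y z)"
      by (cases "V_le x y"; cases "V_le y z"; cases "V_le x z")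
        (use antisym total trans in \<open>simp_all add: bl_inf_V bl_sup_V xyz\<close>)
    then show "bl_inf V_alg (bl_inf V_alg x y) z = bl_inf V_alg x (bl_inf V_alg y z)"
      "bl_sup V_alg (bl_sup V_alg x y) z = bl_sup V_alg x (bl_sup V_alg y z)"
      by blast+
    show "bl_le V_alg (mult V_alg z x) y = bl_le V_alg z (impl V_alg x y)"
      using xyz impl_closed[of x y] impl_iff by (simp add: bl_le_V)
  next
    fix x assume x: "x \<in> carrier V_alg"
    show "bl_le V_alg (bl_zero V_alg) x" "bl_le V_alg x (one V_alg)"
      using x zero_closed by (simp_all add: bl_le_V) (auto simp: carrier_V V_simps hoop_le_std)
  qed (use impl_closed zero_closed chain in auto)
qed

end

theory Submission
  imports Defs "HOL-Library.Multiset"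
begin

text \<open>
  Soundness holds because a BL-algebra validates the axioms of BL, while double negation and the Chang
  axiom are computed directly in \<^const>\<open>V_alg\<close>.

  For completeness, suppose that \<open>\<phi>\<close> is not derivable from the finite set \<open>T\<close>. A maximal theory that
  contains \<open>T\<close> but not \<open>\<phi>\<close> is linear (\<open>linear_extension\<close>), so formulas are totally preordered by
  provable implication. In this chain let the radical consist of the elements \<open>a\<close> with \<open>\<not> a \<le> a\<close>. The
  Chang axiom makes it closed under multiplication (\<open>radical_conj\<close>). As no element is in the radical
  together with its negation, exactly one of \<open>a\<close> and \<open>\<not> a\<close> is, negations of
  radical elements lie below the radical, and multiplication cancels on the radical
  (\<open>radical_cancel\<close>). Thus the chain is the disconnected rotation of a totally ordered
  cancellative hoop.

  It remains to embed finitely many elements of that hoop into \<open>(0,1]\<close> so that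
  the relations between them that matter for the evaluation of subformulas survive. After
  taking logarithms, these relations are homogeneous linear inequalities with integer coefficients.
  Fourier--Motzkin elimination solves such a system over the reals: every
  inequality that it produces is a nonnegative integer combination of the given ones, hence
  holds in the hoop as well, and so cannot be the contradictory \<open>0 < 0\<close> (\<open>real_solution\<close>).
  Rotating the embedding gives an evaluation in \<^const>\<open>V_alg\<close> under which exactly those formulas of
  \<open>T \<union> {\<phi>}\<close> that lie in the theory have value \<open>1\<close> (\<open>refuting_evaluation\<close>).
\<close>

section \<open>Homogeneous linear inequalities over the reals\<close>

text \<open>The predicate \<open>S\<close> marks the strict bounds. The midpoint of the largest lower and the smallest
  upper bound works: if these two coincide, neither is attained by a strict bound.\<close>

lemma point_between_bounds:
  fixes f g :: "'a \<Rightarrow> real"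
  assumes "finite A" "finite B"
    and le: "\<And>a b. a \<in> A \<Longrightarrow> b \<in> B \<Longrightarrow> f a \<le> g b"
    and less: "\<And>a b. a \<in> A \<Longrightarrow> b \<in> B \<Longrightarrow> S a \<or> S b \<Longrightarrow> f a < g b"
  obtains t where "\<And>a. a \<in> A \<Longrightarrow> f a \<le> t" "\<And>a. a \<in> A \<Longrightarrow> S a \<Longrightarrow> f a < t"
    "\<And>b. b \<in> B \<Longrightarrow> t \<le> g b" "\<And>b. b \<in> B \<Longrightarrow> S b \<Longrightarrow> t < g b"
proof (cases "A = {} \<or> B = {}")
  case True
  then show ?thesis
  proof
    assume A: "A = {}"
    define t where "t = (if B = {} then 0 else Min (g ` B) - 1)"
    have "t < g b" if "b \<in> B" for b
    proof -
      have "Min (g ` B) \<le> g b" using \<open>finite B\<close> that by simp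
      with that show ?thesis by (auto simp: t_def)
    qed
    with A show ?thesis by (intro that[of t]) (auto intro: less_imp_le)
  next
    assume B: "B = {}"
    define t where "t = (if A = {} then 0 else Max (f ` A) + 1)"
    have "f a < t" if "a \<in> A" for a
    proof -
      have "f a \<le> Max (f ` A)" using \<open>finite A\<close> that by simp
      with that show ?thesis by (auto simp: t_def)
    qed
    with B show ?thesis by (intro that[of t]) (auto intro: less_imp_le)
  qed
next
  case False
  define l where "l = Max (f ` A)"
  define u where "u = Min (g ` B)"
  have fl: "f a \<le> l" if "a \<in> A" for a using \<open>finite A\<close> that by (simp add: l_def)
  have gu: "u \<le> g b" if "b \<in> B" for b using \<open>finite B\<close> that by (simp add: u_def)
  have "l \<in> f ` A" "u \<in> g ` B" using assms(1,2) False by (auto simp: l_def u_def)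
  then obtain a b where ab: "a \<in> A" "l = f a" "b \<in> B" "u = g b" by auto
  have lu: "l \<le> u" using le ab by simp
  show ?thesis
  proof (intro that[of "(l + u) / 2"])
    fix x assume x: "x \<in> A"
    show "f x \<le> (l + u) / 2" using fl[OF x] lu by simp
    show "f x < (l + u) / 2" if "S x"
      using less[OF x \<open>b \<in> B\<close>] fl[OF x] lu that ab by auto
  next
    fix x assume x: "x \<in> B"
    show "(l + u) / 2 \<le> g x" using gu[OF x] lu by simp
    show "(l + u) / 2 < g x" if "S x"
      using less[OF \<open>a \<in> A\<close> x] gu[OF x] lu that ab by auto
  qed
qed

locale integer_cone =
  fixes N :: "('a \<Rightarrow> int) set"
  assumes zero_in: "(\<lambda>i. 0) \<in> N"
    and add_in: "\<lbrakk>v \<in> N; w \<in> N\<rbrakk> \<Longrightarrow> (\<lambda>i. v i + w i) \<in> N"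
begin

lemma scale_in:
  assumes "w \<in> N" "0 \<le> k"
  shows "(\<lambda>i. k * w i) \<in> N"
proof -
  have "(\<lambda>i. int n * w i) \<in> N" for n
  proof (induction n)
    case (Suc n)
    then show ?case using add_in[OF Suc \<open>w \<in> N\<close>] by (simp add: algebra_simps)
  qed (simp add: zero_in)
  from this[of "nat k"] show ?thesis using assms by simp
qed

text \<open>Positive combinations inherit strictness: if \<open>p v + q w\<close> can be negated inside \<open>N\<close>, then
  \<open>- v = (p - 1) v + q w - (p v + q w)\<close> is in \<open>N\<close>.\<close>

lemma neg_in_of_neg_combination_in:
  assumes "v \<in> N" "w \<in> N" "0 < p" "0 \<le> q" "(\<lambda>i. - (p * v i + q * w i)) \<in> N"
  shows "(\<lambda>i. - v i) \<in> N"
proof -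
  have "(\<lambda>i. (p - 1) * v i) \<in> N" "(\<lambda>i. q * w i) \<in> N"
    using assms by (auto intro: scale_in)
  from add_in[OF add_in[OF this] assms(5)] show ?thesis by (simp add: algebra_simps)
qed

text \<open>Think of \<open>w \<in> N\<close> as an inequality \<open>0 \<le> w\<close> valid in some preordered group, strict
  unless \<open>- w \<in> N\<close>. The proof is Fourier--Motzkin elimination: a coordinate is removed by cancelling it
  between every inequality that bounds it from below and every one that bounds it from above. The
  resulting vectors are again in the cone, and any solution of the smaller system leaves room for a
  value of the removed coordinate. Once no coordinate is left, only the zero vector remains, and
  it is never strict.\<close>

theorem real_solution:
  assumes "finite I" "finite W" "W \<subseteq> N" "\<And>w i. w \<in> W \<Longrightarrow> i \<notin> I \<Longrightarrow> w i = 0"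
  shows "\<exists>r :: 'a \<Rightarrow> real. \<forall>w\<in>W. 0 \<le> (\<Sum>i\<in>I. w i * r i) \<and>
    ((\<lambda>i. - w i) \<notin> N \<longrightarrow> 0 < (\<Sum>i\<in>I. w i * r i))"
  using assms
proof (induction I arbitrary: W rule: finite_induct)
  case empty
  have "(\<lambda>i. - w i) \<in> N" if "w \<in> W" for w
    using empty.prems(3)[OF that] zero_in by simp
  then show ?case by auto
next
  case (insert j I)
  define strict where "strict w \<longleftrightarrow> (\<lambda>i. - w i) \<notin> N" for w :: "'a \<Rightarrow> int"
  define L where "L = {w \<in> W. 0 < w j}"
  define U where "U = {w \<in> W. w j < 0}"
  define comb where "comb a b = (\<lambda>i. (- b j) * a i + a j * b i)" for a b :: "'a \<Rightarrow> int"
  define W' where "W' = {w \<in> W. w j = 0} \<union> (\<lambda>(a, b). comb a b) ` (L \<times> U)"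
  have N: "w \<in> N" if "w \<in> W" for w using that insert.prems by auto
  have comb_N: "comb a b \<in> N" if "a \<in> L" "b \<in> U" for a b
    unfolding comb_def using that N by (intro add_in scale_in) (auto simp: L_def U_def)
  have comb_strict: "strict (comb a b)" if "a \<in> L" "b \<in> U" "strict a \<or> strict b" for a b
    unfolding strict_def
  proof
    assume neg: "(\<lambda>i. - comb a b i) \<in> N"
    have ab: "a \<in> N" "b \<in> N" "0 < a j" "0 < - b j" using that N by (auto simp: L_def U_def)
    have "(\<lambda>i. - a i) \<in> N"
      using neg_in_of_neg_combination_in[OF ab(1,2), of "- b j" "a j"] ab neg by (simp add: comb_def)
    moreover have "(\<lambda>i. - b i) \<in> N"
      using neg_in_of_neg_combination_in[OF ab(2,1), of "a j" "- b j"] ab neg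
      by (simp add: comb_def algebra_simps)
    ultimately show False using that by (auto simp: strict_def)
  qed
  have "finite W'" using insert.prems by (auto simp: W'_def L_def U_def)
  moreover have "W' \<subseteq> N" using comb_N N by (auto simp: W'_def)
  moreover have "w i = 0" if "w \<in> W'" "i \<notin> I" for w i
  proof (cases "i = j")
    case True
    with that show ?thesis by (auto simp: W'_def comb_def)
  next
    case False
    then have zero: "w i = 0" if "w \<in> W" for w using insert.prems that \<open>i \<notin> I\<close> by auto
    from that(1) consider "w \<in> W" | a b where "w = comb a b" "a \<in> W" "b \<in> W"
      by (auto simp: W'_def L_def U_def)
    then show ?thesis by cases (simp_all add: zero comb_def)
  qed
  ultimately obtain r :: "'a \<Rightarrow> real" where r: "\<And>w. w \<in> W' \<Longrightarrow> 0 \<le> (\<Sum>i\<in>I. w i * r i)"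
    "\<And>w. w \<in> W' \<Longrightarrow> strict w \<Longrightarrow> 0 < (\<Sum>i\<in>I. w i * r i)"
    using insert.IH[of W'] unfolding strict_def by blast
  define d where "d w = (\<Sum>i\<in>I. w i * r i)" for w :: "'a \<Rightarrow> int"
  have d_comb: "d (comb a b) = (- b j) * d a + a j * d b" for a b
    unfolding d_def comb_def sum_distrib_left sum.distrib[symmetric]
    by (intro sum.cong) (simp_all add: algebra_simps)
  \<comment> \<open>The value of coordinate \<open>j\<close> at which \<open>w\<close> becomes an equality.\<close>
  define f where "f w = - d w / w j" for w
  have bound: "f a \<le> f b" "strict a \<or> strict b \<Longrightarrow> f a < f b" if "a \<in> L" "b \<in> U" for a b
  proof -
    have j: "0 < a j" "b j < 0" and W: "comb a b \<in> W'" using that by (auto simp: L_def U_def W'_def)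
    have "f a \<le> f b \<longleftrightarrow> 0 \<le> d (comb a b)" "f a < f b \<longleftrightarrow> 0 < d (comb a b)"
      using j by (auto simp: f_def d_comb field_simps)
    then show "f a \<le> f b" "strict a \<or> strict b \<Longrightarrow> f a < f b"
      using r[OF W] comb_strict[OF that] by (auto simp: d_def)
  qed
  have fin: "finite L" "finite U" using insert.prems by (auto simp: L_def U_def)
  obtain t where t: "\<And>a. a \<in> L \<Longrightarrow> f a \<le> t" "\<And>a. a \<in> L \<Longrightarrow> strict a \<Longrightarrow> f a < t"
    "\<And>b. b \<in> U \<Longrightarrow> t \<le> f b" "\<And>b. b \<in> U \<Longrightarrow> strict b \<Longrightarrow> t < f b"
    using point_between_bounds[OF fin, of f f strict] bound by blast
  have sum: "(\<Sum>i\<in>insert j I. w i * (r(j := t)) i) = w j * t + d w" for w :: "'a \<Rightarrow> int"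
  proof -
    have "(\<Sum>i\<in>I. w i * (r(j := t)) i) = d w"
      unfolding d_def using insert.hyps by (intro sum.cong) auto
    then show ?thesis using insert.hyps by simp
  qed
  have "0 \<le> w j * t + d w \<and> (strict w \<longrightarrow> 0 < w j * t + d w)" if "w \<in> W" for w
  proof -
    have "w j = 0 \<or> w \<in> L \<or> w \<in> U" using that by (auto simp: L_def U_def)
    then consider "w j = 0" | "w \<in> L" | "w \<in> U" by blast
    then show ?thesis
    proof cases
      case 1
      then show ?thesis using r[of w] that by (auto simp: W'_def d_def)
    next
      case 2
      then show ?thesis using t(1,2)[OF 2] by (auto simp: L_def f_def field_simps)
    next
      case 3
      then show ?thesis using t(3,4)[OF 3] by (auto simp: U_def f_def field_simps)
    qed
  qed
  then have "\<forall>w\<in>W. 0 \<le> (\<Sum>i\<in>insert j I. w i * (r(j := t)) i) \<and>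
    ((\<lambda>i. - w i) \<notin> N \<longrightarrow> 0 < (\<Sum>i\<in>insert j I. w i * (r(j := t)) i))"
    unfolding sum strict_def by blast
  then show ?case by blast
qed

end


section \<open>Real representation of preordered cancellative monoids\<close>

text \<open>The intended instance consists of formulas preordered by provable implication. The monoid laws
  hold up to the equivalence induced by the preorder, so no passage to equivalence classes is needed.\<close>

locale preordered_cancellative_monoid =
  fixes M :: "'a set" and mul :: "'a \<Rightarrow> 'a \<Rightarrow> 'a" (infixr "\<star>" 70)
    and unit :: 'a and le :: "'a \<Rightarrow> 'a \<Rightarrow> bool" (infix "\<lesssim>" 50)
  assumes unit_closed: "unit \<in> M"
    and mul_closed: "\<lbrakk>x \<in> M; y \<in> M\<rbrakk> \<Longrightarrow> x \<star> y \<in> M"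
    and refl: "x \<lesssim> x"
    and trans [trans]: "\<lbrakk>x \<lesssim> y; y \<lesssim> z\<rbrakk> \<Longrightarrow> x \<lesssim> z"
    and mul_mono: "\<lbrakk>x \<lesssim> y; x' \<lesssim> y'\<rbrakk> \<Longrightarrow> x \<star> x' \<lesssim> y \<star> y'"
    and mul_commute: "x \<star> y \<lesssim> y \<star> x"
    and mul_assoc: "(x \<star> y) \<star> z \<lesssim> x \<star> y \<star> z"
    and unit_right: "x \<star> unit \<lesssim> x" "x \<lesssim> x \<star> unit"
    and cancel: "\<lbrakk>x \<in> M; y \<in> M; z \<in> M; x \<star> y \<lesssim> x \<star> z\<rbrakk> \<Longrightarrow> y \<lesssim> z"
begin

definition product :: "'a list \<Rightarrow> 'a" where
  "product xs = foldr mul xs unit"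

lemma product_simps [simp]: "product [] = unit" "product (x # xs) = x \<star> product xs"
  by (simp_all add: product_def)

lemma product_closed: "set xs \<subseteq> M \<Longrightarrow> product xs \<in> M"
  by (induction xs) (auto intro: unit_closed mul_closed)

lemma mul_assoc': "x \<star> y \<star> z \<lesssim> (x \<star> y) \<star> z"
proof -
  have "x \<star> y \<star> z \<lesssim> (y \<star> z) \<star> x" by (rule mul_commute)
  also have "\<dots> \<lesssim> y \<star> z \<star> x" by (rule mul_assoc)
  also have "\<dots> \<lesssim> (z \<star> x) \<star> y" by (rule mul_commute)
  also have "\<dots> \<lesssim> z \<star> x \<star> y" by (rule mul_assoc)
  also have "\<dots> \<lesssim> (x \<star> y) \<star> z" by (rule mul_commute)
  finally show ?thesis .
qed

lemma product_append:
  "product (xs @ ys) \<lesssim> product xs \<star> product ys" "product xs \<star> product ys \<lesssim> product (xs @ ys)"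
proof (induction xs)
  case Nil
  { case 1 show ?case using trans[OF unit_right(2) mul_commute] by simp }
  { case 2 show ?case using trans[OF mul_commute unit_right(1)] by simp }
next
  case (Cons x xs)
  { case 1
    show ?case using trans[OF mul_mono[OF refl Cons(1)] mul_assoc'] by simp }
  { case 2
    show ?case using trans[OF mul_assoc mul_mono[OF refl Cons(2)]] by simp }
qed

lemma product_permute: "mset xs = mset ys \<Longrightarrow> product xs \<lesssim> product ys"
proof (induction xs arbitrary: ys)
  case Nil
  then show ?case by (simp add: refl)
next
  case (Cons x xs)
  then have "x \<in> set ys" by (metis list.set_intros(1) mset_eq_setD)
  then obtain us vs where ys: "ys = us @ x # vs" by (auto simp: in_set_conv_decomp)
  then have "mset xs = mset (vs @ us)" using Cons.prems by simp
  then have "product xs \<lesssim> product (vs @ us)" by (rule Cons.IH)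
  then have "product (x # xs) \<lesssim> product ((x # vs) @ us)" by (simp add: mul_mono refl)
  also have "\<dots> \<lesssim> product (x # vs) \<star> product us" by (rule product_append)
  also have "\<dots> \<lesssim> product us \<star> product (x # vs)" by (rule mul_commute)
  also have "\<dots> \<lesssim> product ys" unfolding ys by (rule product_append)
  finally show ?case .
qed

definition exponent_difference :: "'a list \<Rightarrow> 'a list \<Rightarrow> 'a \<Rightarrow> int" where
  "exponent_difference xs ys i = int (count_list xs i) - int (count_list ys i)"

definition cone :: "('a \<Rightarrow> int) set" where
  "cone = {exponent_difference xs ys | xs ys. set xs \<subseteq> M \<and> set ys \<subseteq> M \<and> product xs \<lesssim> product ys}"

lemma coneI: "set xs \<subseteq> M \<Longrightarrow> set ys \<subseteq> M \<Longrightarrow> product xs \<lesssim> product ys \<Longrightarrow> exponent_difference xs ys \<in> cone"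
  by (auto simp: cone_def)

lemma integer_cone_cone: "integer_cone cone"
proof
  have "exponent_difference [] [] = (\<lambda>i. 0)" by (simp add: exponent_difference_def fun_eq_iff)
  then show "(\<lambda>i. 0) \<in> cone" using coneI[of "[]" "[]"] by (simp add: refl)
next
  fix v w assume "v \<in> cone" "w \<in> cone"
  then obtain xs ys us vs where
    v: "v = exponent_difference xs ys" "set xs \<subseteq> M" "set ys \<subseteq> M" "product xs \<lesssim> product ys" and
    w: "w = exponent_difference us vs" "set us \<subseteq> M" "set vs \<subseteq> M" "product us \<lesssim> product vs"
    by (auto simp: cone_def)
  have "product (xs @ us) \<lesssim> product xs \<star> product us" by (rule product_append)
  also have "\<dots> \<lesssim> product ys \<star> product vs" using v w by (intro mul_mono)
  also have "\<dots> \<lesssim> product (ys @ vs)" by (rule product_append)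
  finally have "exponent_difference (xs @ us) (ys @ vs) \<in> cone"
    using v w by (intro coneI) auto
  moreover have "exponent_difference (xs @ us) (ys @ vs) = (\<lambda>i. v i + w i)"
    by (simp add: v w exponent_difference_def fun_eq_iff)
  ultimately show "(\<lambda>i. v i + w i) \<in> cone" by simp
qed

text \<open>Cancellation is what makes the order recoverable from exponent vectors: two
  pairs of products with the same difference are comparable in the same way.\<close>

lemma le_of_neg_in_cone:
  assumes "(\<lambda>i. - exponent_difference xs ys i) \<in> cone" "set xs \<subseteq> M" "set ys \<subseteq> M"
  shows "product ys \<lesssim> product xs"
proof -
  obtain us vs where uv: "(\<lambda>i. - exponent_difference xs ys i) = exponent_difference us vs"
    "set us \<subseteq> M" "set vs \<subseteq> M" "product us \<lesssim> product vs"
    using assms(1) by (auto simp: cone_def)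
  have "count_list (vs @ ys) i = count_list (us @ xs) i" for i
    using fun_cong[OF uv(1), of i] by (simp add: exponent_difference_def)
  then have "mset (vs @ ys) = mset (us @ xs)"
    by (intro multiset_eqI) (simp flip: count_mset)
  then have perm: "product (vs @ ys) \<lesssim> product (us @ xs)" by (rule product_permute)
  have "product vs \<star> product ys \<lesssim> product (vs @ ys)" by (rule product_append)
  also note perm
  also have "product (us @ xs) \<lesssim> product us \<star> product xs" by (rule product_append)
  also have "\<dots> \<lesssim> product vs \<star> product xs" using uv by (intro mul_mono refl)
  finally have "product vs \<star> product ys \<lesssim> product vs \<star> product xs" .
  with assms uv product_closed show ?thesis by (metis cancel)
qed

text \<open>Sums of \<open>r\<close> are compared in the reverse order because \<open>r\<close> plays the role of a negative
  logarithm. The bound \<open>n\<close> leaves finitely many inequalities to satisfy; as \<open>M\<close> may have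
  infinitesimals, in general no \<open>r\<close> works for products of all lengths.\<close>

theorem real_representation:
  assumes "finite F" "F \<subseteq> M" and total: "\<And>x y. x \<lesssim> y \<or> y \<lesssim> x"
  shows "\<exists>r :: 'a \<Rightarrow> real. \<forall>xs ys.
    set xs \<subseteq> F \<and> set ys \<subseteq> F \<and> length xs \<le> n \<and> length ys \<le> n \<longrightarrow>
    (product xs \<lesssim> product ys \<longleftrightarrow> sum_list (map r ys) \<le> sum_list (map r xs))"
proof -
  define X where "X = {xs. set xs \<subseteq> F \<and> length xs \<le> n}"
  define W where "W = {exponent_difference xs ys | xs ys. xs \<in> X \<and> ys \<in> X \<and> product xs \<lesssim> product ys}"
  have "finite X" unfolding X_def by (rule finite_lists_length_le) fact
  then have "finite ((\<lambda>(xs, ys). exponent_difference xs ys) ` (X \<times> X))" by auto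
  moreover have "W \<subseteq> (\<lambda>(xs, ys). exponent_difference xs ys) ` (X \<times> X)" by (auto simp: W_def)
  ultimately have "finite W" by (rule rev_finite_subset)
  moreover have "W \<subseteq> cone" using assms(2) by (force simp: W_def X_def intro: coneI)
  moreover have "w i = 0" if "w \<in> W" "i \<notin> F" for w i
  proof -
    have "count_list xs i = 0" if "xs \<in> X" for xs
      using that \<open>i \<notin> F\<close> by (auto simp: X_def count_list_0_iff)
    with \<open>w \<in> W\<close> show ?thesis by (auto simp: W_def exponent_difference_def)
  qed
  ultimately obtain r :: "'a \<Rightarrow> real" where r: "\<And>w. w \<in> W \<Longrightarrow> 0 \<le> (\<Sum>i\<in>F. w i * r i)"
    "\<And>w. w \<in> W \<Longrightarrow> (\<lambda>i. - w i) \<notin> cone \<Longrightarrow> 0 < (\<Sum>i\<in>F. w i * r i)"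
    using integer_cone.real_solution[OF integer_cone_cone \<open>finite F\<close>, of W] by blast
  have sum: "(\<Sum>i\<in>F. exponent_difference xs ys i * r i) = sum_list (map r xs) - sum_list (map r ys)"
    if "xs \<in> X" "ys \<in> X" for xs ys
  proof -
    have "(\<Sum>i\<in>F. count_list zs i * r i) = sum_list (map r zs)" if "set zs \<subseteq> F" for zs
      using that
    proof (induction zs)
      case (Cons z zs)
      have "(\<Sum>i\<in>F. count_list (z # zs) i * r i)
          = (\<Sum>i\<in>F. count_list zs i * r i + (if i = z then r i else 0))"
        by (intro sum.cong) (auto simp: algebra_simps)
      then show ?case using Cons \<open>finite F\<close> by (simp add: sum.distrib)
    qed simp
    with that show ?thesis
      by (simp add: X_def exponent_difference_def left_diff_distrib sum_subtractf)
  qed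
  have le: "sum_list (map r ys) \<le> sum_list (map r xs)"
    if "xs \<in> X" "ys \<in> X" "product xs \<lesssim> product ys" for xs ys
    using r(1)[of "exponent_difference xs ys"] sum[OF that(1,2)] that by (auto simp: W_def)
  have less: "sum_list (map r ys) < sum_list (map r xs)"
    if "xs \<in> X" "ys \<in> X" "product xs \<lesssim> product ys" "\<not> product ys \<lesssim> product xs" for xs ys
  proof -
    have "(\<lambda>i. - exponent_difference xs ys i) \<notin> cone"
      using le_of_neg_in_cone that assms(2) by (auto simp: X_def)
    moreover have "exponent_difference xs ys \<in> W" using that by (auto simp: W_def)
    ultimately show ?thesis using r(2) sum[OF that(1,2)] by fastforce
  qed
  show ?thesis
  proof (intro exI[of _ r] allI impI)
    fix xs ys assume "set xs \<subseteq> F \<and> set ys \<subseteq> F \<and> length xs \<le> n \<and> length ys \<le> n"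
    then have "xs \<in> X" "ys \<in> X" by (auto simp: X_def)
    then show "product xs \<lesssim> product ys \<longleftrightarrow> sum_list (map r ys) \<le> sum_list (map r xs)"
      using le less[of ys xs] total[of "product xs" "product ys"] by fastforce
  qed
qed

end


section \<open>Theories of basic logic\<close>

locale bl_theory =
  fixes Th :: "form set"
  assumes BL_subset: "BL \<subseteq> Th"
    and mp: "\<lbrakk>\<phi> \<in> Th; (\<phi> \<^bold>\<rightarrow> \<psi>) \<in> Th\<rbrakk> \<Longrightarrow> \<psi> \<in> Th"
begin

definition le :: "form \<Rightarrow> form \<Rightarrow> bool" (infix "\<preceq>" 50) where
  "a \<preceq> b \<longleftrightarrow> (a \<^bold>\<rightarrow> b) \<in> Th"

lemma BL_Th: "\<phi> \<in> BL \<Longrightarrow> \<phi> \<in> Th"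
  using BL_subset by auto

lemma le_trans [trans]: "a \<preceq> b \<Longrightarrow> b \<preceq> c \<Longrightarrow> a \<preceq> c"
  unfolding le_def by (rule mp[OF _ mp[OF _ BL_Th[OF BL.intros(1)]]])

lemma mp_le: "a \<in> Th \<Longrightarrow> a \<preceq> b \<Longrightarrow> b \<in> Th"
  unfolding le_def by (rule mp)

lemma conj_le1: "a \<^bold>& b \<preceq> a"
  and conj_commute: "a \<^bold>& b \<preceq> b \<^bold>& a"
  and divisibility: "a \<^bold>& (a \<^bold>\<rightarrow> b) \<preceq> b \<^bold>& (b \<^bold>\<rightarrow> a)"
  and curry1: "(a \<^bold>\<rightarrow> b \<^bold>\<rightarrow> c) \<preceq> (a \<^bold>& b \<^bold>\<rightarrow> c)"
  and curry2: "(a \<^bold>& b \<^bold>\<rightarrow> c) \<preceq> (a \<^bold>\<rightarrow> b \<^bold>\<rightarrow> c)"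
  and bot_le: "\<^bold>\<bottom> \<preceq> a"
  unfolding le_def by (intro BL_Th BL.intros)+

lemma residuation: "a \<^bold>& b \<preceq> c \<longleftrightarrow> a \<preceq> (b \<^bold>\<rightarrow> c)"
  unfolding le_def
  by (rule iffI; erule mp; rule curry1[unfolded le_def] curry2[unfolded le_def])

lemma conj_le2: "a \<^bold>& b \<preceq> b"
  using conj_commute conj_le1 by (rule le_trans)

lemma le_imp: "a \<preceq> (b \<^bold>\<rightarrow> a)"
  using conj_le1 by (simp flip: residuation)

lemma exchange_rule: "a \<preceq> (b \<^bold>\<rightarrow> c) \<Longrightarrow> b \<preceq> (a \<^bold>\<rightarrow> c)"
  unfolding residuation[symmetric] by (rule le_trans[OF conj_commute])

lemma le_refl: "a \<preceq> a"
proof -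
  have "(a \<^bold>& a \<^bold>\<rightarrow> a) \<in> Th" using conj_le1 by (simp add: le_def)
  moreover have "(a \<^bold>& a \<^bold>\<rightarrow> a) \<preceq> (a \<^bold>\<rightarrow> a)" using le_imp by (rule exchange_rule)
  ultimately show ?thesis unfolding le_def by (rule mp)
qed

lemma le_theorem: "b \<in> Th \<Longrightarrow> a \<preceq> b"
  unfolding le_def[of a] by (rule mp_le[OF _ le_imp])

lemma imp_conj_le: "(a \<^bold>\<rightarrow> b) \<^bold>& a \<preceq> b"
  using le_refl by (simp add: residuation)

lemma conj_imp_le: "a \<^bold>& (a \<^bold>\<rightarrow> b) \<preceq> b"
  using conj_commute imp_conj_le by (rule le_trans)

lemma le_imp_conj: "a \<preceq> (b \<^bold>\<rightarrow> a \<^bold>& b)"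
  using le_refl by (simp flip: residuation)

lemma conj_mono:
  assumes "a \<preceq> b" "c \<preceq> d"
  shows "a \<^bold>& c \<preceq> b \<^bold>& d"
proof -
  have left: "x \<^bold>& z \<preceq> y \<^bold>& z" if "x \<preceq> y" for x y z
    using le_trans[OF that le_imp_conj] by (simp add: residuation)
  have "a \<^bold>& c \<preceq> b \<^bold>& c" using assms(1) by (rule left)
  also have "\<dots> \<preceq> c \<^bold>& b" by (rule conj_commute)
  also have "\<dots> \<preceq> d \<^bold>& b" using assms(2) by (rule left)
  also have "\<dots> \<preceq> b \<^bold>& d" by (rule conj_commute)
  finally show ?thesis .
qed

lemma conj_assoc: "(a \<^bold>& b) \<^bold>& c \<preceq> a \<^bold>& b \<^bold>& c"
  using le_trans[OF le_imp_conj curry2, of a b c] by (simp add: residuation)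

lemma conj_assoc': "a \<^bold>& b \<^bold>& c \<preceq> (a \<^bold>& b) \<^bold>& c"
proof -
  have "a \<preceq> (b \<^bold>\<rightarrow> c \<^bold>\<rightarrow> (a \<^bold>& b) \<^bold>& c)"
    by (simp flip: residuation add: le_refl)
  then show ?thesis unfolding residuation using curry1 by (rule le_trans)
qed

lemma theorem_conj: "a \<in> Th \<Longrightarrow> b \<preceq> b \<^bold>& a"
  unfolding le_def[of b] by (rule mp_le[OF _ exchange_rule[OF le_imp_conj]])

lemma imp_mono: "a \<preceq> b \<Longrightarrow> (c \<^bold>\<rightarrow> a) \<preceq> (c \<^bold>\<rightarrow> b)"
  unfolding residuation[symmetric] by (rule le_trans[OF imp_conj_le])

lemma imp_antimono: "a \<preceq> b \<Longrightarrow> (b \<^bold>\<rightarrow> c) \<preceq> (a \<^bold>\<rightarrow> c)"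
  unfolding residuation[symmetric] by (rule le_trans[OF conj_mono[OF le_refl] imp_conj_le])

lemma exchange: "(a \<^bold>\<rightarrow> b \<^bold>\<rightarrow> c) \<preceq> (b \<^bold>\<rightarrow> a \<^bold>\<rightarrow> c)"
proof -
  have "(a \<^bold>\<rightarrow> b \<^bold>\<rightarrow> c) \<preceq> (a \<^bold>& b \<^bold>\<rightarrow> c)" by (rule curry1)
  also have "\<dots> \<preceq> (b \<^bold>& a \<^bold>\<rightarrow> c)" using conj_commute by (rule imp_antimono)
  also have "\<dots> \<preceq> (b \<^bold>\<rightarrow> a \<^bold>\<rightarrow> c)" by (rule curry2)
  finally show ?thesis .
qed

end

text \<open>The formula \<open>d \<^bold>\<rightarrow> \<dots> \<^bold>\<rightarrow> d \<^bold>\<rightarrow> a\<close>, equivalent to \<open>d\<^sup>n \<^bold>\<rightarrow> a\<close>.\<close>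

primrec imp_pow :: "form \<Rightarrow> nat \<Rightarrow> form \<Rightarrow> form" where
  "imp_pow d 0 a = a"
| "imp_pow d (Suc n) a = (d \<^bold>\<rightarrow> imp_pow d n a)"

lemma imp_pow_add: "imp_pow d m (imp_pow d n a) = imp_pow d (m + n) a"
  by (induction m) simp_all

context bl_theory
begin

lemma imp_pow_mono: "a \<preceq> b \<Longrightarrow> imp_pow d n a \<preceq> imp_pow d n b"
  by (induction n) (simp_all add: imp_mono)

lemma le_imp_pow: "a \<preceq> imp_pow d n a"
  by (induction n) (simp_all add: le_refl le_trans[OF _ le_imp])

lemma imp_pow_exchange: "imp_pow d n (a \<^bold>\<rightarrow> b) \<preceq> (a \<^bold>\<rightarrow> imp_pow d n b)"
proof (induction n)
  case (Suc n)
  show ?case using le_trans[OF imp_mono[OF Suc] exchange] by simp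
qed (simp add: le_refl)

lemma imp_pow_mp:
  assumes "imp_pow d m a \<in> Th" "imp_pow d n (a \<^bold>\<rightarrow> b) \<in> Th"
  shows "imp_pow d (m + n) b \<in> Th"
proof -
  have "a \<preceq> imp_pow d n b" using mp_le[OF assms(2) imp_pow_exchange] by (simp add: le_def)
  then show ?thesis using mp_le[OF assms(1) imp_pow_mono] imp_pow_add by metis
qed

text \<open>The prelinearity axiom is the case \<open>m = n = 1\<close>. It can be applied to \<open>c\<close> preceded by all but one of
  the premises, so it removes one occurrence at a time.\<close>

lemma imp_pow_prelinear:
  assumes "imp_pow (a \<^bold>\<rightarrow> b) m c \<in> Th" "imp_pow (b \<^bold>\<rightarrow> a) n c \<in> Th"
  shows "c \<in> Th"
proof -
  have prelinear: "z \<in> Th" if "(x \<^bold>\<rightarrow> y) \<preceq> z" "(y \<^bold>\<rightarrow> x) \<preceq> z" for x y z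
    using that unfolding le_def by (rule mp[OF _ mp[OF _ BL_Th[OF BL.intros(7)]], rotated])
  have one: "z \<in> Th" if "imp_pow (x \<^bold>\<rightarrow> y) k z \<in> Th" "(y \<^bold>\<rightarrow> x) \<preceq> z" for x y z k
    using that
  proof (induction k)
    case (Suc k)
    have "imp_pow (x \<^bold>\<rightarrow> y) k z \<in> Th"
      using Suc.prems le_trans[OF Suc.prems(2) le_imp_pow] by (intro prelinear[of x y]) (auto simp: le_def)
    with Suc show ?case by blast
  qed simp
  show ?thesis using assms(2)
  proof (induction n)
    case (Suc n)
    have "imp_pow (a \<^bold>\<rightarrow> b) m (imp_pow (b \<^bold>\<rightarrow> a) n c) \<in> Th"
      using assms(1) imp_pow_mono[OF le_imp_pow] by (rule mp_le)
    moreover have "(b \<^bold>\<rightarrow> a) \<preceq> imp_pow (b \<^bold>\<rightarrow> a) n c" using Suc.prems by (simp add: le_def)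
    ultimately have "imp_pow (b \<^bold>\<rightarrow> a) n c \<in> Th" by (rule one)
    then show ?case by (rule Suc.IH)
  qed simp
qed

end


section \<open>Extension to linear theories\<close>

lemma bl_theory_derivable: "BL \<subseteq> L \<Longrightarrow> bl_theory {\<phi>. derivable L T \<phi>}"
  by unfold_locales (auto intro: derivable.intros)

text \<open>The ordinary deduction theorem fails because a premise may be used several times and \<open>d\<close>
  need not imply \<open>d \<^bold>& d\<close>.\<close>

lemma local_deduction:
  assumes "BL \<subseteq> L" "derivable L (insert d T) \<phi>"
  shows "\<exists>n. derivable L T (imp_pow d n \<phi>)"
proof -
  interpret bl_theory "{\<phi>. derivable L T \<phi>}" using assms(1) by (rule bl_theory_derivable)
  show ?thesis using assms(2)
  proof induction
    case (ax \<phi>)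
    then show ?case using derivable.ax[of \<phi> L T] by (metis imp_pow.simps(1))
  next
    case (hyp \<phi>)
    have "derivable L T (imp_pow d 1 d)" using le_refl[of d] by (simp add: le_def)
    moreover have "derivable L T (imp_pow d 0 \<phi>)" if "\<phi> \<in> T" using that by (simp add: derivable.hyp)
    ultimately show ?case using hyp by blast
  next
    case (mp \<phi> \<psi>)
    then show ?case using imp_pow_mp by blast
  qed
qed

lemma derivable_mono: "derivable L S \<phi> \<Longrightarrow> S \<subseteq> T \<Longrightarrow> derivable L T \<phi>"
  by (induction rule: derivable.induct) (auto intro: derivable.intros)

lemma derivable_cut: "derivable L (insert \<psi> T) \<phi> \<Longrightarrow> derivable L T \<psi> \<Longrightarrow> derivable L T \<phi>"
  by (induction rule: derivable.induct) (auto intro: derivable.intros)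

lemma derivable_Union_chain:
  assumes "derivable L (\<Union>C) \<phi>" "subset.chain \<A> C" "C \<noteq> {}"
  shows "\<exists>S\<in>C. derivable L S \<phi>"
  using assms(1)
proof induction
  case (ax \<phi>)
  then show ?case using assms(3) by (auto intro: derivable.ax)
next
  case (hyp \<phi>)
  then show ?case by (auto intro: derivable.hyp)
next
  case (mp \<phi> \<psi>)
  then obtain S S' where S: "S \<in> C" "S' \<in> C" "derivable L S \<phi>" "derivable L S' (\<phi> \<^bold>\<rightarrow> \<psi>)" by blast
  then have "S \<subseteq> S' \<or> S' \<subseteq> S" using assms(2) by (auto simp: subset.chain_def)
  then show ?case using S derivable_mono derivable.mp by metis
qed

locale linear_theory = bl_theory +
  assumes linear: "a \<preceq> b \<or> b \<preceq> a"

text \<open>A maximal theory that does not derive \<open>\<phi>\<close> is linear: otherwise \<open>\<phi>\<close> would follow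
  from each of \<open>a \<^bold>\<rightarrow> b\<close> and \<open>b \<^bold>\<rightarrow> a\<close>, hence by local deduction from finitely many copies of each, and
  prelinearity would discharge these.\<close>

theorem linear_extension:
  assumes "BL \<subseteq> L" "\<not> derivable L T \<phi>"
  obtains Th where "linear_theory Th" "L \<subseteq> Th" "T \<subseteq> Th" "\<phi> \<notin> Th"
proof -
  define \<A> where "\<A> = {S. T \<subseteq> S \<and> \<not> derivable L S \<phi>}"
  have "\<exists>M\<in>\<A>. \<forall>X\<in>\<A>. M \<subseteq> X \<longrightarrow> X = M"
  proof (rule subset_Zorn_nonempty)
    show "\<A> \<noteq> {}" using assms(2) by (auto simp: \<A>_def)
  next
    fix C assume C: "C \<noteq> {}" "subset.chain \<A> C"
    then have "C \<subseteq> \<A>" by (auto simp: subset.chain_def)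
    then show "\<Union>C \<in> \<A>" using derivable_Union_chain[OF _ C(2,1), of L \<phi>] C(1) by (fastforce simp: \<A>_def)
  qed
  then obtain M where M: "T \<subseteq> M" "\<not> derivable L M \<phi>"
    and max: "\<And>X. T \<subseteq> X \<Longrightarrow> \<not> derivable L X \<phi> \<Longrightarrow> M \<subseteq> X \<Longrightarrow> X = M"
    unfolding \<A>_def by auto
  have derives: "derivable L (insert \<psi> M) \<phi>" if "\<psi> \<notin> M" for \<psi>
    using max[of "insert \<psi> M"] M that by auto
  have closed: "\<psi> \<in> M \<longleftrightarrow> derivable L M \<psi>" for \<psi>
    using derives derivable_cut M derivable.hyp by metis
  then have M_eq: "M = {\<psi>. derivable L M \<psi>}" by auto
  have bl: "bl_theory M" by (subst M_eq) (rule bl_theory_derivable[OF assms(1)])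
  interpret bl_theory M by (rule bl)
  have "(a \<^bold>\<rightarrow> b) \<in> M \<or> (b \<^bold>\<rightarrow> a) \<in> M" for a b
  proof (rule ccontr)
    assume "\<not> ((a \<^bold>\<rightarrow> b) \<in> M \<or> (b \<^bold>\<rightarrow> a) \<in> M)"
    then have "derivable L (insert (a \<^bold>\<rightarrow> b) M) \<phi>" "derivable L (insert (b \<^bold>\<rightarrow> a) M) \<phi>"
      by (auto intro: derives)
    then obtain m n where "imp_pow (a \<^bold>\<rightarrow> b) m \<phi> \<in> M" "imp_pow (b \<^bold>\<rightarrow> a) n \<phi> \<in> M"
      using local_deduction[OF assms(1)] closed by metis
    then have "\<phi> \<in> M" by (rule imp_pow_prelinear)
    with M closed show False by simp
  qed
  then have "linear_theory M" by unfold_locales (simp add: le_def)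
  moreover have "L \<subseteq> M" using closed derivable.ax by auto
  ultimately show ?thesis using that M closed by auto
qed


section \<open>Linear theories of the Chang logic\<close>

locale chang_chain = linear_theory +
  assumes Luk_Chang_subset: "Luk_Chang \<subseteq> Th"
    and consistent: "\<^bold>\<bottom> \<notin> Th"
begin

lemma neg_neg_le: "Neg (Neg a) \<preceq> a"
proof -
  have "(Neg (Neg a) \<^bold>\<rightarrow> a) \<in> Luk_Chang" by (auto simp: Luk_Chang_def Luk_def)
  then show ?thesis using Luk_Chang_subset by (auto simp: le_def)
qed

lemma le_neg_iff: "a \<preceq> Neg b \<longleftrightarrow> a \<^bold>& b \<preceq> \<^bold>\<bottom>"
  by (simp add: Neg_def residuation)

lemma le_neg_neg: "a \<preceq> Neg (Neg a)"
  unfolding le_neg_iff unfolding Neg_def by (rule conj_imp_le)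

lemma neg_antimono: "a \<preceq> b \<Longrightarrow> Neg b \<preceq> Neg a"
  unfolding Neg_def by (rule imp_antimono)

lemma neg_le_swap: "Neg a \<preceq> b \<Longrightarrow> Neg b \<preceq> a"
  by (rule le_trans[OF neg_antimono neg_neg_le])

text \<open>The elements infinitely close to \<open>1\<close>, that is, the copy of the hoop inside its rotation.\<close>

definition radical :: "form \<Rightarrow> bool" where
  "radical a \<longleftrightarrow> Neg a \<preceq> a"

lemma radical_mono:
  assumes "radical a" "a \<preceq> b"
  shows "radical b"
proof -
  have "Neg b \<preceq> Neg a" using assms(2) by (rule neg_antimono)
  also have "\<dots> \<preceq> a" using assms(1) by (simp add: radical_def)
  also note assms(2)
  finally show ?thesis by (simp add: radical_def)
qed

lemma radical_theorem: "a \<in> Th \<Longrightarrow> radical a"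
  by (simp add: radical_def le_theorem)

lemma radical_iff_Dbl: "radical a \<longleftrightarrow> Dbl a \<in> Th"
proof -
  have "Neg a \<preceq> a \<longleftrightarrow> Neg a \<preceq> Neg (Neg a)"
    using le_trans le_neg_neg neg_neg_le by blast
  also have "\<dots> \<longleftrightarrow> Dbl a \<in> Th"
    unfolding le_neg_iff by (simp add: Dbl_def Neg_def le_def)
  finally show ?thesis by (simp add: radical_def)
qed

text \<open>By the Chang axiom, \<open>2a = 1\<close> implies \<open>2(a\<^sup>2) = (2a)\<^sup>2 = 1\<close>.\<close>

lemma radical_square:
  assumes "radical a"
  shows "radical (a \<^bold>& a)"
proof -
  have "(Sq (Dbl a) \<^bold>\<leftrightarrow> Dbl (Sq a)) \<in> Luk_Chang" by (auto simp: Luk_Chang_def)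
  then have "(Sq (Dbl a) \<^bold>\<leftrightarrow> Dbl (Sq a)) \<in> Th" using Luk_Chang_subset by auto
  then have "Sq (Dbl a) \<preceq> Dbl (Sq a)"
    unfolding Iff_def using mp_le[OF _ conj_le1] by (simp add: le_def)
  moreover have "Dbl a \<in> Th" using assms by (simp add: radical_iff_Dbl)
  then have "Sq (Dbl a) \<in> Th" unfolding Sq_def using theorem_conj mp_le by blast
  ultimately have "Dbl (Sq a) \<in> Th" by (metis mp_le)
  then show ?thesis by (simp add: radical_iff_Dbl Sq_def)
qed

text \<open>In a chain the product of two elements lies above the square of the smaller one.\<close>

lemma radical_conj:
  assumes "radical a" "radical b"
  shows "radical (a \<^bold>& b)"
  using linear[of a b]
proof
  assume "a \<preceq> b"
  then show ?thesis using radical_mono[OF radical_square[OF assms(1)]] conj_mono[OF le_refl] by blast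
next
  assume "b \<preceq> a"
  then show ?thesis using radical_mono[OF radical_square[OF assms(2)]] conj_mono[OF _ le_refl] by blast
qed

lemma not_radical_bot: "\<not> radical \<^bold>\<bottom>"
proof
  assume "radical \<^bold>\<bottom>"
  then have "Neg \<^bold>\<bottom> \<preceq> \<^bold>\<bottom>" by (simp add: radical_def)
  moreover have "Neg \<^bold>\<bottom> \<in> Th" using le_refl by (simp add: Neg_def le_def)
  ultimately show False using consistent mp_le by blast
qed

lemma radical_neg_iff: "radical (Neg a) \<longleftrightarrow> \<not> radical a"
proof
  assume "radical (Neg a)"
  show "\<not> radical a"
  proof
    assume "radical a"
    then have "radical (a \<^bold>& Neg a)" using \<open>radical (Neg a)\<close> by (rule radical_conj)
    then have "radical \<^bold>\<bottom>" using conj_imp_le unfolding Neg_def by (rule radical_mono)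
    with not_radical_bot show False ..
  qed
next
  assume "\<not> radical a"
  then have "a \<preceq> Neg a" using linear by (auto simp: radical_def)
  then show "radical (Neg a)" using neg_neg_le le_trans by (auto simp: radical_def)
qed

lemma le_of_not_radical: "\<not> radical a \<Longrightarrow> radical b \<Longrightarrow> a \<preceq> b"
  using linear[of a b] radical_mono[of b a] by blast

lemma divisibility_le:
  assumes "b \<preceq> a"
  shows "b \<preceq> a \<^bold>& (a \<^bold>\<rightarrow> b)"
proof -
  have "b \<preceq> b \<^bold>& (b \<^bold>\<rightarrow> a)" using assms by (intro theorem_conj) (simp add: le_def)
  also have "\<dots> \<preceq> a \<^bold>& (a \<^bold>\<rightarrow> b)" by (rule divisibility)
  finally show ?thesis .
qed

text \<open>In an MV-chain \<open>a \<^bold>\<rightarrow> a \<^bold>& c\<close> is the maximum of \<open>c\<close> and \<open>Neg a\<close>. For \<open>a\<close> and \<open>c\<close> in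
  the radical this is \<open>c\<close>, since negations of radical elements lie below the radical.\<close>

lemma radical_imp_conj_le:
  assumes "radical a" "radical c"
  shows "(a \<^bold>\<rightarrow> a \<^bold>& c) \<preceq> c"
proof -
  let ?x = "a \<^bold>\<rightarrow> a \<^bold>& c"
  have "Neg c \<preceq> a" using assms by (intro le_of_not_radical) (simp_all add: radical_neg_iff)
  then have "Neg c \<preceq> a \<^bold>& (a \<^bold>\<rightarrow> Neg c)" by (rule divisibility_le)
  then have "?x \<^bold>& Neg c \<preceq> ?x \<^bold>& a \<^bold>& (a \<^bold>\<rightarrow> Neg c)" by (intro conj_mono le_refl)
  also have "\<dots> \<preceq> (?x \<^bold>& a) \<^bold>& (a \<^bold>\<rightarrow> Neg c)" by (rule conj_assoc')
  also have "\<dots> \<preceq> (a \<^bold>& c) \<^bold>& (a \<^bold>\<rightarrow> Neg c)" by (intro conj_mono imp_conj_le le_refl)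
  also have "\<dots> \<preceq> (c \<^bold>& a) \<^bold>& (a \<^bold>\<rightarrow> Neg c)" by (intro conj_mono conj_commute le_refl)
  also have "\<dots> \<preceq> c \<^bold>& a \<^bold>& (a \<^bold>\<rightarrow> Neg c)" by (rule conj_assoc)
  also have "\<dots> \<preceq> c \<^bold>& Neg c" by (intro conj_mono conj_imp_le le_refl)
  also have "\<dots> \<preceq> \<^bold>\<bottom>" unfolding Neg_def by (rule conj_imp_le)
  finally have "?x \<preceq> Neg (Neg c)" by (simp add: le_neg_iff)
  then show ?thesis using neg_neg_le by (rule le_trans)
qed

lemma radical_cancel:
  assumes "radical a" "radical b" "radical c" "a \<^bold>& b \<preceq> a \<^bold>& c"
  shows "b \<preceq> c"
proof -
  have "b \<preceq> (a \<^bold>\<rightarrow> a \<^bold>& b)" using le_imp_conj by (rule exchange_rule)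
  also have "\<dots> \<preceq> (a \<^bold>\<rightarrow> a \<^bold>& c)" using assms(4) by (rule imp_mono)
  also have "\<dots> \<preceq> c" using assms(1,3) by (rule radical_imp_conj_le)
  finally show ?thesis .
qed

lemma top_Th: "(\<^bold>\<bottom> \<^bold>\<rightarrow> \<^bold>\<bottom>) \<in> Th"
  using le_refl by (simp add: le_def)

sublocale rad: preordered_cancellative_monoid "{a. radical a}" "(\<^bold>&)" "\<^bold>\<bottom> \<^bold>\<rightarrow> \<^bold>\<bottom>" le
proof
  show "\<^bold>\<bottom> \<^bold>\<rightarrow> \<^bold>\<bottom> \<in> {a. radical a}" using top_Th by (simp add: radical_theorem)
  show "x \<preceq> x \<^bold>& (\<^bold>\<bottom> \<^bold>\<rightarrow> \<^bold>\<bottom>)" for x using top_Th by (rule theorem_conj)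
  show "x \<preceq> z" if "x \<preceq> y" "y \<preceq> z" for x y z using that by (rule le_trans)
  show "y \<preceq> z"
    if "x \<in> {a. radical a}" "y \<in> {a. radical a}" "z \<in> {a. radical a}" "x \<^bold>& y \<preceq> x \<^bold>& z" for x y z
    using that by (auto intro: radical_cancel)
qed (simp_all add: radical_conj le_refl conj_mono conj_commute conj_assoc conj_le1)

text \<open>Exponentiating turns the additive representation into one by numbers in \<open>(0,1]\<close>. Products of
  length at most two suffice, since residua are determined by products and the order.\<close>

lemma radical_representation:
  assumes "finite F" "\<And>a. a \<in> F \<Longrightarrow> radical a"
  shows "\<exists>g :: form \<Rightarrow> real.
    (\<forall>a\<in>F. 0 < g a \<and> g a \<le> 1 \<and> (g a = 1 \<longleftrightarrow> a \<in> Th)) \<and>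
    (\<forall>a\<in>F. \<forall>b\<in>F. g a \<le> g b \<longleftrightarrow> a \<preceq> b) \<and>
    (\<forall>a\<in>F. \<forall>b\<in>F. \<forall>c\<in>F. a \<^bold>& b \<preceq> c \<and> c \<preceq> a \<^bold>& b \<longrightarrow> g c = g a * g b)"
proof -
  have F: "F \<subseteq> {a. radical a}" using assms(2) by auto
  obtain r :: "form \<Rightarrow> real" where "\<forall>xs ys. set xs \<subseteq> F \<and> set ys \<subseteq> F \<and> length xs \<le> 2 \<and> length ys \<le> 2 \<longrightarrow>
      (rad.product xs \<preceq> rad.product ys \<longleftrightarrow> sum_list (map r ys) \<le> sum_list (map r xs))"
    using rad.real_representation[OF assms(1) F linear, where n = 2] ..
  then have r: "rad.product xs \<preceq> rad.product ys \<longleftrightarrow> sum_list (map r ys) \<le> sum_list (map r xs)"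
    if "set xs \<subseteq> F" "set ys \<subseteq> F" "length xs \<le> 2" "length ys \<le> 2" for xs ys
    using that by simp
  let ?u = "\<^bold>\<bottom> \<^bold>\<rightarrow> \<^bold>\<bottom>"
  have unit: "x \<^bold>& ?u \<preceq> x" "x \<preceq> x \<^bold>& ?u" for x
    by (rule rad.unit_right)+
  have unit2: "x \<^bold>& y \<^bold>& ?u \<preceq> x \<^bold>& y" "x \<^bold>& y \<preceq> x \<^bold>& y \<^bold>& ?u" for x y
    using unit by (auto intro: conj_mono le_refl)
  have unit_iff: "x \<^bold>& ?u \<preceq> z \<longleftrightarrow> x \<preceq> z" "z \<preceq> x \<^bold>& ?u \<longleftrightarrow> z \<preceq> x"
    "x \<^bold>& y \<^bold>& ?u \<preceq> z \<longleftrightarrow> x \<^bold>& y \<preceq> z" "z \<preceq> x \<^bold>& y \<^bold>& ?u \<longleftrightarrow> z \<preceq> x \<^bold>& y" for x y z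
    by (meson unit unit2 le_trans)+
  have r1: "a \<preceq> b \<longleftrightarrow> r b \<le> r a" if "a \<in> F" "b \<in> F" for a b
    using r[of "[a]" "[b]"] that by (simp add: unit_iff)
  have Th: "?u \<preceq> a \<longleftrightarrow> a \<in> Th" "a \<preceq> ?u" for a
    using le_theorem[of a] mp_le[OF top_Th] le_theorem[OF top_Th] by blast+
  have r0: "0 \<le> r a" "r a \<le> 0 \<longleftrightarrow> a \<in> Th" if "a \<in> F" for a
    using r[of "[a]" "[]"] r[of "[]" "[a]"] that by (simp_all add: unit_iff Th)
  have r2: "r c = r a + r b" if "a \<in> F" "b \<in> F" "c \<in> F" "a \<^bold>& b \<preceq> c" "c \<preceq> a \<^bold>& b" for a b c
    using r[of "[a, b]" "[c]"] r[of "[c]" "[a, b]"] that by (simp add: unit_iff)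
  show ?thesis
  proof (intro exI[of _ "\<lambda>a. exp (- r a)"] conjI ballI impI)
    show "exp (- r a) = 1 \<longleftrightarrow> a \<in> Th" if "a \<in> F" for a
      using r0[OF that] by auto
    show "exp (- r c) = exp (- r a) * exp (- r b)"
      if "a \<in> F" "b \<in> F" "c \<in> F" "a \<^bold>& b \<preceq> c \<and> c \<preceq> a \<^bold>& b" for a b c
      using r2 that by (simp flip: exp_add)
  qed (use r0 r1 in auto)
qed

lemma neg_imp_le: "Neg (a \<^bold>\<rightarrow> b) \<preceq> a \<^bold>& Neg b"
proof (rule neg_le_swap)
  have "Neg (a \<^bold>& Neg b) \<preceq> (a \<^bold>\<rightarrow> Neg (Neg b))" unfolding Neg_def by (rule curry2)
  also have "\<dots> \<preceq> (a \<^bold>\<rightarrow> b)" using neg_neg_le by (rule imp_mono)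
  finally show "Neg (a \<^bold>& Neg b) \<preceq> (a \<^bold>\<rightarrow> b)" .
qed

lemma le_neg_imp: "a \<^bold>& Neg b \<preceq> Neg (a \<^bold>\<rightarrow> b)"
proof -
  have "(a \<^bold>& Neg b) \<^bold>& (a \<^bold>\<rightarrow> b) \<preceq> (Neg b \<^bold>& a) \<^bold>& (a \<^bold>\<rightarrow> b)" by (intro conj_mono conj_commute le_refl)
  also have "\<dots> \<preceq> Neg b \<^bold>& a \<^bold>& (a \<^bold>\<rightarrow> b)" by (rule conj_assoc)
  also have "\<dots> \<preceq> Neg b \<^bold>& b" by (intro conj_mono conj_imp_le le_refl)
  also have "\<dots> \<preceq> \<^bold>\<bottom>" unfolding Neg_def by (rule imp_conj_le)
  finally show ?thesis by (simp add: le_neg_iff)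
qed

lemma contraposition: "(a \<^bold>\<rightarrow> b) \<preceq> (Neg b \<^bold>\<rightarrow> Neg a)" "(Neg b \<^bold>\<rightarrow> Neg a) \<preceq> (a \<^bold>\<rightarrow> b)"
proof -
  have contra: "(x \<^bold>\<rightarrow> y) \<preceq> (Neg y \<^bold>\<rightarrow> Neg x)" for x y
    unfolding le_def Neg_def by (intro BL_Th BL.intros)
  show "(a \<^bold>\<rightarrow> b) \<preceq> (Neg b \<^bold>\<rightarrow> Neg a)" by (rule contra)
  have "(Neg b \<^bold>\<rightarrow> Neg a) \<preceq> (Neg (Neg a) \<^bold>\<rightarrow> Neg (Neg b))" by (rule contra)
  also have "\<dots> \<preceq> (Neg (Neg a) \<^bold>\<rightarrow> b)" using neg_neg_le by (rule imp_mono)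
  also have "\<dots> \<preceq> (a \<^bold>\<rightarrow> b)" using le_neg_neg by (rule imp_antimono)
  finally show "(Neg b \<^bold>\<rightarrow> Neg a) \<preceq> (a \<^bold>\<rightarrow> b)" .
qed

end


section \<open>Evaluation in the standard rotation\<close>

primrec subformulas :: "form \<Rightarrow> form set" where
  "subformulas (Var n) = {Var n}"
| "subformulas (a \<^bold>& b) = insert (a \<^bold>& b) (subformulas a \<union> subformulas b)"
| "subformulas (a \<^bold>\<rightarrow> b) = insert (a \<^bold>\<rightarrow> b) (subformulas a \<union> subformulas b)"
| "subformulas \<^bold>\<bottom> = {\<^bold>\<bottom>}"

lemma finite_subformulas: "finite (subformulas a)"
  by (induction a) simp_all

lemma subformulas_refl: "a \<in> subformulas a"
  by (cases a) simp_all

context chang_chain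
begin

text \<open>The theory is the rotation of its radical, so a representation of finitely many
  radical elements by numbers in \<open>(0,1]\<close> rotates to an evaluation in \<^const>\<open>V_alg\<close>.\<close>

theorem refuting_evaluation:
  assumes "finite T" "T \<subseteq> Th" "\<phi> \<notin> Th"
  shows "\<not> entails V_alg T \<phi>"
proof -
  define S where "S = (\<Union>\<psi>\<in>insert \<phi> T. subformulas \<psi>)"
  \<comment> \<open>The radical representative of \<open>a\<close>; it alone receives a number.\<close>
  define h where "h a = (if radical a then a else Neg a)" for a
  have "finite (h ` S)" using assms(1) by (auto simp: S_def finite_subformulas)
  moreover have "radical a" if "a \<in> h ` S" for a
    using that by (auto simp: h_def radical_neg_iff)
  ultimately have "\<exists>g :: form \<Rightarrow> real.
      (\<forall>a\<in>h ` S. 0 < g a \<and> g a \<le> 1 \<and> (g a = 1 \<longleftrightarrow> a \<in> Th)) \<and>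
      (\<forall>a\<in>h ` S. \<forall>b\<in>h ` S. g a \<le> g b \<longleftrightarrow> a \<preceq> b) \<and>
      (\<forall>a\<in>h ` S. \<forall>b\<in>h ` S. \<forall>c\<in>h ` S.
        a \<^bold>& b \<preceq> c \<and> c \<preceq> a \<^bold>& b \<longrightarrow> g c = g a * g b)"
    by (rule radical_representation)
  then obtain g :: "form \<Rightarrow> real" where
    unit_interval: "\<forall>a\<in>h ` S. 0 < g a \<and> g a \<le> 1 \<and> (g a = 1 \<longleftrightarrow> a \<in> Th)" and
    order: "\<forall>a\<in>h ` S. \<forall>b\<in>h ` S. g a \<le> g b \<longleftrightarrow> a \<preceq> b" and
    conj: "\<forall>a\<in>h ` S. \<forall>b\<in>h ` S. \<forall>c\<in>h ` S.
      a \<^bold>& b \<preceq> c \<and> c \<preceq> a \<^bold>& b \<longrightarrow> g c = g a * g b" by (elim exE conjE) (rule that)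
  have g: "0 < g a" "g a \<le> 1" "g a = 1 \<longleftrightarrow> a \<in> Th" if "a \<in> h ` S" for a
    using unit_interval that by blast+
  have g_order: "g a \<le> g b \<longleftrightarrow> a \<preceq> b" if "a \<in> h ` S" "b \<in> h ` S" for a b
    using order that by blast
  have g_conj: "g c = g a * g b"
    if "a \<in> h ` S" "b \<in> h ` S" "c \<in> h ` S" "a \<^bold>& b \<preceq> c" "c \<preceq> a \<^bold>& b" for a b c
    using conj that by blast
  \<comment> \<open>If \<open>b\<close> lies below \<open>a\<close>, then \<open>a * (a \<Rightarrow> b) = b\<close> by divisibility, which determines the residuum.\<close>
  have g_imp: "g c = min 1 (g b / g a)"
    if F: "a \<in> h ` S" "b \<in> h ` S" "c \<in> h ` S" and c: "c \<preceq> (a \<^bold>\<rightarrow> b)" "(a \<^bold>\<rightarrow> b) \<preceq> c" for a b c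
  proof (cases "a \<preceq> b")
    case True
    then have "c \<in> Th" using mp_le[OF _ c(2)] by (simp add: le_def)
    then have "g c = 1" using g(3) F by blast
    moreover have "g a \<le> g b" using g_order F True by blast
    then have "1 \<le> g b / g a" using g(1)[OF F(1)] by simp
    ultimately show ?thesis by simp
  next
    case False
    then have ba: "b \<preceq> a" using linear by blast
    have "a \<^bold>& c \<preceq> b" using conj_mono[OF le_refl c(1)] conj_imp_le by (rule le_trans)
    moreover have "b \<preceq> a \<^bold>& c" using divisibility_le[OF ba] conj_mono[OF le_refl c(2)] by (rule le_trans)
    ultimately have "g b = g a * g c" using F by (intro g_conj)
    then have "g c = g b / g a" using g(1)[OF F(1)] by simp
    with g(2)[OF F(3)] show ?thesis by simp
  qed
  define val where "val a = (if radical a then Inl (g a) else Inr (g (Neg a)))" for a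
  \<comment> \<open>Variables outside \<open>S\<close> have no number; any element of the carrier will do for them.\<close>
  define v where "v n = (if Var n \<in> S then val (Var n) else Inl 1)" for n
  have memb: "radical a \<Longrightarrow> a \<in> h ` S" "\<not> radical a \<Longrightarrow> Neg a \<in> h ` S" if "a \<in> S" for a
    using that by (force simp: h_def)+
  have eval: "eval_form V_alg v a = val a" if "subformulas a \<subseteq> S" for a
    using that
  proof (induction a)
    case (Var n)
    then show ?case by (simp add: v_def)
  next
    case Bot
    have "Neg \<^bold>\<bottom> \<in> Th" using top_Th by (simp add: Neg_def)
    then show ?case
      using memb[of "\<^bold>\<bottom>"] Bot g(3) not_radical_bot by (simp add: val_def V_simps)
  next
    case (Conj a b)
    then have S: "a \<in> S" "b \<in> S" "a \<^bold>& b \<in> S"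
      and IH: "eval_form V_alg v a = val a" "eval_form V_alg v b = val b"
      using subformulas_refl by auto
    have residual: "Neg (x \<^bold>& y) \<preceq> (x \<^bold>\<rightarrow> Neg y)" "(x \<^bold>\<rightarrow> Neg y) \<preceq> Neg (x \<^bold>& y)" for x y
      unfolding Neg_def by (rule curry2 curry1)+
    consider "radical a" "radical b" | "radical a" "\<not> radical b" | "\<not> radical a" "radical b"
      | "\<not> radical a" "\<not> radical b" by blast
    then have "val a \<otimes>\<^bsub>V_alg\<^esub> val b = val (a \<^bold>& b)"
    proof cases
      case 1
      then have "radical (a \<^bold>& b)" by (rule radical_conj)
      then show ?thesis
        using 1 S memb g_conj[of a b "a \<^bold>& b"] le_refl by (simp add: val_def V_simps)
    next
      case 2
      then have "\<not> radical (a \<^bold>& b)" using radical_mono[OF _ conj_le2] by blast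
      then show ?thesis
        using 2 S memb g_imp[of a "Neg b" "Neg (a \<^bold>& b)"] residual by (simp add: val_def V_simps)
    next
      case 3
      then have "\<not> radical (a \<^bold>& b)" using radical_mono[OF _ conj_le1] by blast
      moreover have "Neg (a \<^bold>& b) \<preceq> (b \<^bold>\<rightarrow> Neg a)" "(b \<^bold>\<rightarrow> Neg a) \<preceq> Neg (a \<^bold>& b)"
        using le_trans[OF neg_antimono[OF conj_commute] residual(1)]
        le_trans[OF residual(2) neg_antimono[OF conj_commute]] by simp_all
      ultimately show ?thesis
        using 3 S memb g_imp[of b "Neg a" "Neg (a \<^bold>& b)"] by (simp add: val_def V_simps)
    next
      case 4
      then have "\<not> radical (a \<^bold>& b)" using radical_mono[OF _ conj_le1] by blast
      moreover have "a \<preceq> Neg b" using 4 by (intro le_of_not_radical) (simp_all add: radical_neg_iff)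
      then have "Neg (a \<^bold>& b) \<in> Th" unfolding le_neg_iff by (simp add: le_def Neg_def)
      ultimately show ?thesis using 4 S memb g(3) by (simp add: val_def V_simps)
    qed
    then show ?case by (simp add: IH)
  next
    case (Imp a b)
    then have S: "a \<in> S" "b \<in> S" "(a \<^bold>\<rightarrow> b) \<in> S"
      and IH: "eval_form V_alg v a = val a" "eval_form V_alg v b = val b"
      using subformulas_refl by auto
    consider "radical a" "radical b" | "radical a" "\<not> radical b" | "\<not> radical a" "radical b"
      | "\<not> radical a" "\<not> radical b" by blast
    then have "impl V_alg (val a) (val b) = val (a \<^bold>\<rightarrow> b)"
    proof cases
      case 1
      then have "radical (a \<^bold>\<rightarrow> b)" by (intro radical_mono[OF _ le_imp])
      then show ?thesis
        using 1 S memb g_imp[of a b "a \<^bold>\<rightarrow> b"] le_refl by (simp add: val_def V_simps)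
    next
      case 2
      then have "\<not> radical (a \<^bold>\<rightarrow> b)" using radical_mono[OF radical_conj conj_imp_le] by blast
      then show ?thesis
        using 2 S memb g_conj[of a "Neg b" "Neg (a \<^bold>\<rightarrow> b)"] neg_imp_le le_neg_imp
        by (simp add: val_def V_simps)
    next
      case 3
      then have "(a \<^bold>\<rightarrow> b) \<in> Th" using le_of_not_radical by (simp add: le_def)
      then show ?thesis using 3 S memb g(3) radical_theorem by (simp add: val_def V_simps)
    next
      case 4
      then have "radical (Neg b \<^bold>\<rightarrow> Neg a)" using radical_mono[OF _ le_imp] by (simp add: radical_neg_iff)
      then have "radical (a \<^bold>\<rightarrow> b)" using contraposition(2) by (rule radical_mono)
      then show ?thesis
        using 4 S memb g_imp[of "Neg b" "Neg a" "a \<^bold>\<rightarrow> b"] contraposition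
        by (simp add: val_def V_simps)
    qed
    then show ?case by (simp add: IH)
  qed
  have sub: "subformulas \<psi> \<subseteq> S" if "\<psi> \<in> insert \<phi> T" for \<psi>
    using that by (auto simp: S_def)
  have one: "eval_form V_alg v \<psi> = one V_alg \<longleftrightarrow> \<psi> \<in> Th" if "\<psi> \<in> insert \<phi> T" for \<psi>
  proof -
    have "\<psi> \<in> S" using sub[OF that] subformulas_refl by auto
    then show ?thesis
      using eval[OF sub[OF that]] memb[of \<psi>] g(3)[of \<psi>] radical_theorem[of \<psi>]
      by (auto simp: val_def V_simps)
  qed
  have "evaluation V_alg v"
    using memb g(1,2) by (auto simp: evaluation_def carrier_V v_def val_def)
  then show ?thesis using one assms by (auto simp: entails_def)
qed

end


section \<open>Soundness\<close>

context bl_algebra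
begin

lemma le_refl: "x \<in> carrier A \<Longrightarrow> bl_le A x x"
  using inf_sup_absorb sup_inf_absorb inf_closed unfolding bl_le_def by metis

lemma le_trans:
  "\<lbrakk>bl_le A x y; bl_le A y z; x \<in> carrier A; y \<in> carrier A; z \<in> carrier A\<rbrakk> \<Longrightarrow> bl_le A x z"
  using inf_assoc unfolding bl_le_def by metis

lemma le_antisym: "\<lbrakk>bl_le A x y; bl_le A y x; x \<in> carrier A; y \<in> carrier A\<rbrakk> \<Longrightarrow> x = y"
  using inf_commute unfolding bl_le_def by metis

lemma eq_one_iff: "x \<in> carrier A \<Longrightarrow> x = \<one>\<^bsub>A\<^esub> \<longleftrightarrow> bl_le A \<one>\<^bsub>A\<^esub> x"
  using le_antisym one_greatest le_refl by auto

lemma impl_eq_one_iff: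
  "\<lbrakk>x \<in> carrier A; y \<in> carrier A\<rbrakk> \<Longrightarrow> impl A x y = \<one>\<^bsub>A\<^esub> \<longleftrightarrow> bl_le A x y"
  using residuation[of x y "\<one>\<^bsub>A\<^esub>"] by (simp add: eq_one_iff impl_closed)

lemma mult_mono:
  assumes "bl_le A x y" "x \<in> carrier A" "y \<in> carrier A" "z \<in> carrier A"
  shows "bl_le A (x \<otimes>\<^bsub>A\<^esub> z) (y \<otimes>\<^bsub>A\<^esub> z)"
proof -
  have "bl_le A y (impl A z (y \<otimes>\<^bsub>A\<^esub> z))" using assms le_refl by (simp flip: residuation)
  then have "bl_le A x (impl A z (y \<otimes>\<^bsub>A\<^esub> z))" using assms le_trans impl_closed by (metis m_closed)
  then show ?thesis using assms by (simp add: residuation)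
qed

lemma impl_mult_le: "\<lbrakk>x \<in> carrier A; y \<in> carrier A\<rbrakk> \<Longrightarrow> bl_le A (impl A x y \<otimes>\<^bsub>A\<^esub> x) y"
  using le_refl impl_closed by (simp add: residuation)

lemma mult_le_left: "\<lbrakk>x \<in> carrier A; y \<in> carrier A\<rbrakk> \<Longrightarrow> bl_le A (x \<otimes>\<^bsub>A\<^esub> y) x"
  using mult_mono[OF one_greatest, of y x] by (simp add: m_comm)

lemma impl_impl: "\<lbrakk>x \<in> carrier A; y \<in> carrier A; z \<in> carrier A\<rbrakk>
  \<Longrightarrow> impl A x (impl A y z) = impl A (x \<otimes>\<^bsub>A\<^esub> y) z"
proof (rule le_antisym)
  assume xyz: "x \<in> carrier A" "y \<in> carrier A" "z \<in> carrier A"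
  have "bl_le A w (impl A x (impl A y z)) \<longleftrightarrow> bl_le A w (impl A (x \<otimes>\<^bsub>A\<^esub> y) z)" if "w \<in> carrier A" for w
    using xyz that by (simp add: impl_closed m_assoc flip: residuation)
  then show "bl_le A (impl A x (impl A y z)) (impl A (x \<otimes>\<^bsub>A\<^esub> y) z)"
    "bl_le A (impl A (x \<otimes>\<^bsub>A\<^esub> y) z) (impl A x (impl A y z))"
    using xyz le_refl impl_closed by (meson m_closed)+
qed (simp_all add: impl_closed)

lemma sup_le:
  assumes "bl_le A x z" "bl_le A y z" "x \<in> carrier A" "y \<in> carrier A" "z \<in> carrier A"
  shows "bl_le A (bl_sup A x y) z"
proof -
  have "bl_sup A x z = z" "bl_sup A y z = z"
    using assms sup_inf_absorb[of z x] sup_inf_absorb[of z y] inf_commute sup_commute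
    unfolding bl_le_def by metis+
  then have "bl_sup A (bl_sup A x y) z = z" using assms by (simp add: sup_assoc)
  then show ?thesis
    using inf_sup_absorb[of "bl_sup A x y" z] assms sup_closed unfolding bl_le_def by metis
qed

lemma impl_transitive:
  assumes "x \<in> carrier A" "y \<in> carrier A" "z \<in> carrier A"
  shows "bl_le A (impl A x y) (impl A (impl A y z) (impl A x z))"
proof -
  have "bl_le A ((impl A x y \<otimes>\<^bsub>A\<^esub> impl A y z) \<otimes>\<^bsub>A\<^esub> x) (y \<otimes>\<^bsub>A\<^esub> impl A y z)"
    using mult_mono[OF impl_mult_le, of x y "impl A y z"] assms
    by (simp add: impl_closed m_ac)
  moreover have "bl_le A (y \<otimes>\<^bsub>A\<^esub> impl A y z) z"
    using assms impl_mult_le[of y z] by (simp add: m_comm impl_closed)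
  ultimately have "bl_le A ((impl A x y \<otimes>\<^bsub>A\<^esub> impl A y z) \<otimes>\<^bsub>A\<^esub> x) z"
    by (rule le_trans) (simp_all add: assms impl_closed)
  then show ?thesis using assms by (simp add: impl_closed flip: residuation)
qed

text \<open>Let \<open>u\<close> be the product of the two premises. Then \<open>x \<Rightarrow> y\<close> and \<open>y \<Rightarrow> x\<close> both lie below \<open>u \<Rightarrow> z\<close>, and so
  does their join, which is \<open>1\<close>.\<close>

lemma prelinear:
  assumes "x \<in> carrier A" "y \<in> carrier A" "z \<in> carrier A"
  shows "bl_le A (impl A (impl A x y) z) (impl A (impl A (impl A y x) z) z)"
proof -
  let ?p = "impl A (impl A x y) z" and ?q = "impl A (impl A y x) z"
  have c: "impl A x y \<in> carrier A" "impl A y x \<in> carrier A" "?p \<in> carrier A" "?q \<in> carrier A"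
    using assms by (simp_all add: impl_closed)
  let ?u = "?p \<otimes>\<^bsub>A\<^esub> ?q"
  have "bl_le A (?p \<otimes>\<^bsub>A\<^esub> impl A x y) z" "bl_le A (?q \<otimes>\<^bsub>A\<^esub> impl A y x) z"
    using assms c by (simp_all add: impl_mult_le)
  moreover have "bl_le A ((?p \<otimes>\<^bsub>A\<^esub> impl A x y) \<otimes>\<^bsub>A\<^esub> ?q) (?p \<otimes>\<^bsub>A\<^esub> impl A x y)"
    "bl_le A ((?q \<otimes>\<^bsub>A\<^esub> impl A y x) \<otimes>\<^bsub>A\<^esub> ?p) (?q \<otimes>\<^bsub>A\<^esub> impl A y x)"
    using c by (simp_all add: mult_le_left)
  ultimately have "bl_le A ((?p \<otimes>\<^bsub>A\<^esub> impl A x y) \<otimes>\<^bsub>A\<^esub> ?q) z"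
    "bl_le A ((?q \<otimes>\<^bsub>A\<^esub> impl A y x) \<otimes>\<^bsub>A\<^esub> ?p) z"
    using c assms le_trans by (meson m_closed)+
  then have "bl_le A (impl A x y \<otimes>\<^bsub>A\<^esub> ?u) z" "bl_le A (impl A y x \<otimes>\<^bsub>A\<^esub> ?u) z"
    using c by (simp_all add: m_ac)
  then have "bl_le A (impl A x y) (impl A ?u z)" "bl_le A (impl A y x) (impl A ?u z)"
    using c assms by (simp_all add: residuation)
  then have "bl_le A (bl_sup A (impl A x y) (impl A y x)) (impl A ?u z)"
    using c assms by (intro sup_le) (simp_all add: impl_closed)
  then have "bl_le A \<one>\<^bsub>A\<^esub> (impl A ?u z)" using assms by (simp add: prelinearity)
  then have "bl_le A ?u z" using c assms by (simp flip: residuation)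
  then show ?thesis using c assms by (simp add: residuation)
qed

lemma eval_closed: "evaluation A v \<Longrightarrow> eval_form A v \<phi> \<in> carrier A"
  by (induction \<phi>) (auto simp: evaluation_def impl_closed zero_closed)

lemma BL_sound:
  assumes "\<phi> \<in> BL" "evaluation A v"
  shows "eval_form A v \<phi> = \<one>\<^bsub>A\<^esub>"
proof -
  note closed = eval_closed[OF assms(2)] impl_closed zero_closed
  show ?thesis using assms(1)
  proof cases
    case (4 \<phi> \<psi>)
    have "eval_form A v \<phi> \<otimes>\<^bsub>A\<^esub> impl A (eval_form A v \<phi>) (eval_form A v \<psi>) =
        eval_form A v \<psi> \<otimes>\<^bsub>A\<^esub> impl A (eval_form A v \<psi>) (eval_form A v \<phi>)"
      using closed inf_divisibility inf_commute by metis
    then show ?thesis using 4 by (simp add: impl_eq_one_iff closed le_refl)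
  next
    case (5 a b c)
    then show ?thesis by (simp add: impl_impl impl_eq_one_iff closed impl_mult_le)
  next
    case (6 a b c)
    then show ?thesis by (simp add: impl_impl impl_eq_one_iff closed impl_mult_le)
  qed (simp_all add: impl_eq_one_iff closed le_refl mult_le_left m_comm zero_least
      impl_transitive prelinear)
qed

lemma derivable_sound:
  assumes "derivable L T \<phi>" "evaluation A v"
    "\<And>\<psi>. \<psi> \<in> L \<union> T \<Longrightarrow> eval_form A v \<psi> = \<one>\<^bsub>A\<^esub>"
  shows "eval_form A v \<phi> = \<one>\<^bsub>A\<^esub>"
  using assms(1)
proof induction
  case (mp \<phi> \<psi>)
  have "bl_le A (eval_form A v \<phi>) (eval_form A v \<psi>)"
    using mp.IH(2) eval_closed[OF assms(2)] by (simp add: impl_eq_one_iff)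
  then show ?case using mp.IH(1) eval_closed[OF assms(2)] by (simp add: eq_one_iff)
qed (use assms(3) in auto)

end

lemma Luk_Chang_sound:
  assumes "\<phi> \<in> Luk_Chang" "evaluation V_alg v"
  shows "eval_form V_alg v \<phi> = one V_alg"
proof -
  interpret bl_algebra V_alg by (rule bl_algebra_V)
  have eval: "\<exists>a. 0 < a \<and> a \<le> 1 \<and> (eval_form V_alg v \<psi> = Inl a \<or> eval_form V_alg v \<psi> = Inr a)" for \<psi>
    using eval_closed[OF assms(2)] by (simp add: carrier_V)
  consider "\<phi> \<in> BL" | \<psi> where "\<phi> = (Neg (Neg \<psi>) \<^bold>\<rightarrow> \<psi>)" | \<psi> where "\<phi> = (Sq (Dbl \<psi>) \<^bold>\<leftrightarrow> Dbl (Sq \<psi>))"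
    using assms(1) by (auto simp: Luk_Chang_def Luk_def)
  then show ?thesis
  proof cases
    case 1
    then show ?thesis using assms(2) by (rule BL_sound)
  next
    case (2 \<psi>)
    then show ?thesis using eval[of \<psi>] by (auto simp: Neg_def V_simps)
  next
    case (3 \<psi>)
    then show ?thesis using eval[of \<psi>] by (auto simp: Neg_def Sq_def Dbl_def Iff_def V_simps mult_le_one)
  qed
qed

theorem corollary3p5:
  shows "finitely_strongly_complete Luk_Chang V_alg"
  unfolding finitely_strongly_complete_def
proof (intro allI impI iffI)
  fix T :: "form set" and \<phi> assume T: "finite T"
  {
    assume "derivable Luk_Chang T \<phi>"
    then show "entails V_alg T \<phi>"
      unfolding entails_def using Luk_Chang_sound
      by (intro allI impI, elim bl_algebra.derivable_sound[OF bl_algebra_V]) auto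
  next
    assume entails: "entails V_alg T \<phi>"
    show "derivable Luk_Chang T \<phi>"
    proof (rule ccontr)
      assume "\<not> derivable Luk_Chang T \<phi>"
      moreover have "BL \<subseteq> Luk_Chang" by (auto simp: Luk_Chang_def Luk_def)
      ultimately obtain Th where Th: "linear_theory Th" "Luk_Chang \<subseteq> Th" "T \<subseteq> Th" "\<phi> \<notin> Th"
        using linear_extension by metis
      interpret linear_theory Th by fact
      have "\<^bold>\<bottom> \<notin> Th" using Th(4) bot_le mp_le by blast
      with Th(2) interpret chang_chain Th by unfold_locales
      show False using refuting_evaluation[OF T Th(3,4)] entails by simp
    qed
  }
qed

end
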